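(* Let $\Omega\subset\mathbb C^n$ be a bounded open set and $q\in\mathbb R$, $q>1$. Suppose that for every $\zeta\in\partial\Omega$ there exists $f_\zeta\in\bigcap_{p<q}\mathcal{O}L^p(\Omega)$ with $\lim_{z\to\zeta,\,z\in\Omega}f_\zeta(z)=\infty$. Then the set of functions $g\in\bigcap_{p<q}\mathcal{O}L^p(\Omega)$ which are totally unbounded in $\Omega$ is dense and $G_\delta$ in $\bigcap_{p<q}\mathcal{O}L^p(\Omega)$. Also the set of functions $h\in\bigcap_{p<q}\mathcal{O}L^p(\Omega)$ which are singular at every boundary point of $\Omega$ is dense and $G_\delta$ in $\bigcap_{p<q}\mathcal{O}L^p(\Omega)$. The same conclusions hold for $q=\infty$.
   Context: For a bounded open $\Omega\subset\mathbb C^n$ and $p\ge1$, $\mathcal{O}L^p(\Omega)$ is the Banach space of holomorphic $f:\Omega\to\mathbb C$ with $\|f\|_p=(\int_\Omega|f|^p\,dv)^{1/p}<\infty$ ($dv$ = Lebesgue measure); $\mathcal{O}L^\infty(\Omega)$ is the space of bounded holomorphic functions with the sup norm. For $1<q\le\infty$, $\bigcap_{p<q}\mathcal{O}L^p(\Omega)$ carries the complete metric $d(f,g)=\sum_j 2^{-j}\frac{\|f-g\|_{p_j}}{1+\|f-g\|_{p_j}}$ where $1<p_1<p_2<\dots<q$, $p_j\to q$; thus $f_k\to f$ iff $\|f_k-f\|_p\to0$ for every $p<q$; it is a topological vector space. A holomorphic $f$ is totally unbounded in $\Omega$ if for every $w\in\partial\Omega$, $\delta>0$ and every connected component $E$ of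 $B(w,\delta)\cap\Omega$, $\sup_E|f|=\infty$. A holomorphic $f$ on $\Omega$ is singular at every boundary point of $\Omega$ if whenever $U,V\subset\mathbb C^n$ are open, $U$ connected, $\emptyset\ne V\subseteq U\cap\Omega\ne U$, there is no holomorphic $F$ on $U$ with $F=f$ on $V$. *)

theory Defs
  imports "HOL-Analysis.Analysis"
begin

definition holo_on :: "(complex ^ 'n) set \<Rightarrow> (complex ^ 'n \<Rightarrow> complex) \<Rightarrow> bool" where
  "holo_on S f \<longleftrightarrow>
     (\<forall>z\<in>S. \<exists>L. (f has_derivative L) (at z) \<and> (\<forall>c v. L (c *s v) = c * L v))"

definition Lp_norm :: "real \<Rightarrow> (complex ^ 'n) set \<Rightarrow> (complex ^ 'n \<Rightarrow> complex) \<Rightarrow> real" where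
  "Lp_norm p \<Omega> f = enn2real (\<integral>\<^sup>+ x\<in>\<Omega>. ennreal (cmod (f x) powr p) \<partial>lborel) powr (1 / p)"

text \<open>The space of holomorphic functions on Omega lying in OL^p for all 1 <= p < q.
  Functions are normalised to vanish outside Omega, so that they are determined
  by their values on Omega.\<close>
definition OLq :: "ereal \<Rightarrow> (complex ^ 'n) set \<Rightarrow> (complex ^ 'n \<Rightarrow> complex) set" where
  "OLq q \<Omega> = {f. holo_on \<Omega> f \<and> (\<forall>x. x \<notin> \<Omega> \<longrightarrow> f x = 0) \<and>
     (\<forall>p. 1 \<le> p \<and> ereal p < q \<longrightarrow> (\<integral>\<^sup>+ x\<in>\<Omega>. ennreal (cmod (f x) powr p) \<partial>lborel) < \<infinity>)}"

text \<open>The metric d(f,g) = sum_j 2^{-j} N_j/(1+N_j), N_j = norm of f-g in L^{p_j};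
  ps j stands for p_{j+1}.\<close>
definition OLdist :: "(nat \<Rightarrow> real) \<Rightarrow> (complex ^ 'n) set \<Rightarrow>
    (complex ^ 'n \<Rightarrow> complex) \<Rightarrow> (complex ^ 'n \<Rightarrow> complex) \<Rightarrow> real" where
  "OLdist ps \<Omega> f g = (\<Sum>j. (1/2) ^ (Suc j) *
      (Lp_norm (ps j) \<Omega> (\<lambda>z. f z - g z) / (1 + Lp_norm (ps j) \<Omega> (\<lambda>z. f z - g z))))"

definition admissible_seq :: "ereal \<Rightarrow> (nat \<Rightarrow> real) \<Rightarrow> bool" where
  "admissible_seq q ps \<longleftrightarrow> 1 < ps 0 \<and> strict_mono ps \<and> (\<forall>j. ereal (ps j) < q)
     \<and> ((\<lambda>j. ereal (ps j)) \<longlonglongrightarrow> q)"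

definition OL_open :: "ereal \<Rightarrow> (nat \<Rightarrow> real) \<Rightarrow> (complex ^ 'n) set \<Rightarrow>
    (complex ^ 'n \<Rightarrow> complex) set \<Rightarrow> bool" where
  "OL_open q ps \<Omega> U \<longleftrightarrow> U \<subseteq> OLq q \<Omega> \<and>
     (\<forall>f\<in>U. \<exists>e>0. \<forall>g\<in>OLq q \<Omega>. OLdist ps \<Omega> f g < e \<longrightarrow> g \<in> U)"

definition OL_dense :: "ereal \<Rightarrow> (nat \<Rightarrow> real) \<Rightarrow> (complex ^ 'n) set \<Rightarrow>
    (complex ^ 'n \<Rightarrow> complex) set \<Rightarrow> bool" where
  "OL_dense q ps \<Omega> A \<longleftrightarrow> A \<subseteq> OLq q \<Omega> \<and>
     (\<forall>f\<in>OLq q \<Omega>. \<forall>e>0. \<exists>g\<in>A. OLdist ps \<Omega> f g < e)"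

definition OL_Gdelta :: "ereal \<Rightarrow> (nat \<Rightarrow> real) \<Rightarrow> (complex ^ 'n) set \<Rightarrow>
    (complex ^ 'n \<Rightarrow> complex) set \<Rightarrow> bool" where
  "OL_Gdelta q ps \<Omega> A \<longleftrightarrow>
     (\<exists>U :: nat \<Rightarrow> (complex ^ 'n \<Rightarrow> complex) set. (\<forall>k. OL_open q ps \<Omega> (U k)) \<and> A = (\<Inter>k. U k))"

definition totally_unbounded :: "(complex ^ 'n) set \<Rightarrow> (complex ^ 'n \<Rightarrow> complex) \<Rightarrow> bool" where
  "totally_unbounded \<Omega> f \<longleftrightarrow>
     (\<forall>w\<in>frontier \<Omega>. \<forall>\<delta>>0. \<forall>E\<in>components (ball w \<delta> \<inter> \<Omega>).
        (SUP z\<in>E. ereal (cmod (f z))) = \<infinity>)"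

definition singular_at_boundary :: "(complex ^ 'n) set \<Rightarrow> (complex ^ 'n \<Rightarrow> complex) \<Rightarrow> bool" where
  "singular_at_boundary \<Omega> f \<longleftrightarrow>
     (\<forall>U V. open U \<and> open V \<and> connected U \<and> V \<noteq> {} \<and> V \<subseteq> U \<inter> \<Omega> \<and> U \<inter> \<Omega> \<noteq> U \<longrightarrow>
        \<not> (\<exists>F. holo_on U F \<and> (\<forall>z\<in>V. F z = f z)))"

end

theory Submission
  imports Defs "HOL-Complex_Analysis.Great_Picard"
begin

text \<open>
  Baire category in the complete metric space \<open>X = OLq q \<Omega>\<close>. By the mean value property, the value
  at a point is bounded by the \<open>L\<^sup>p\<close> norm, so convergence in \<open>X\<close> is locally uniform and \<open>X\<close> is
  complete. A component \<open>E\<close> of \<open>U \<inter> \<Omega>\<close>, for a connected open \<open>U\<close> not inside \<open>\<Omega>\<close>, accumulates at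
  a boundary point \<open>\<zeta> \<in> U\<close>, and \<open>E\<close> contains a component of \<open>B \<inter> \<Omega>\<close> for a ball \<open>B\<close> near \<open>\<zeta>\<close>
  taken from a countable family. Hence total unboundedness is a countable intersection of the
  conditions \<open>sup\<^sub>E |g| > m\<close>; each is open, and dense because adding a small multiple of the
  function blowing up at \<open>\<zeta>\<close> to a function bounded on \<open>E\<close> makes it unbounded on \<open>E\<close>.
  Likewise, \<open>h\<close> is singular at the boundary iff, for no pair \<open>(B, E)\<close> of the family and no \<open>m\<close>,
  \<open>h\<close> extends from \<open>E\<close> to a function on \<open>B\<close> that is bounded by \<open>m\<close> and \<open>m\<close>-Lipschitz; by
  Arzela-Ascoli, being so extendable is a closed condition. Totally unbounded functions satisfy the
  singularity condition, which gives density of the latter.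
\<close>

section \<open>Holomorphic functions of several variables\<close>

definition complex_homogeneous :: "(complex ^ 'n \<Rightarrow> complex) \<Rightarrow> bool" where
  "complex_homogeneous L \<longleftrightarrow> (\<forall>c v. L (c *s v) = c * L v)"

lemma norm_vector_smult:
  "norm (c *s v) = norm c * norm v" for v :: "'a::real_normed_div_algebra ^ 'n"
  by (simp add: norm_vec_def norm_mult L2_set_right_distrib)

lemma bounded_linear_vector_smult_left:
  "bounded_linear (\<lambda>t. t *s v)" for v :: "'a::real_normed_div_algebra ^ 'n"
proof (rule bounded_linear_intro)
  show "(x + y) *s v = x *s v + y *s v" for x y
    by (rule vector_sadd_rdistrib)
  show "(r *\<^sub>R x) *s v = r *\<^sub>R (x *s v)" for r x
    by (simp add: vec_eq_iff)
  show "norm (x *s v) \<le> norm x * norm v" for x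
    by (simp add: norm_vector_smult)
qed

lemma holo_on_iff_frechet_derivative:
  "holo_on S f \<longleftrightarrow>
    (\<forall>z\<in>S. f differentiable (at z) \<and> complex_homogeneous (frechet_derivative f (at z)))"
  unfolding holo_on_def complex_homogeneous_def
  by (metis differentiableI frechet_derivative_at frechet_derivative_works)

lemma holo_onI:
  assumes "\<And>z. z \<in> S \<Longrightarrow> (f has_derivative L z) (at z)" "\<And>z. z \<in> S \<Longrightarrow> complex_homogeneous (L z)"
  shows "holo_on S f"
  using assms unfolding holo_on_def complex_homogeneous_def by blast

lemma holo_on_has_derivative:
  assumes "holo_on S f" "z \<in> S"
  shows "(f has_derivative frechet_derivative f (at z)) (at z)"
  using assms by (simp add: holo_on_iff_frechet_derivative frechet_derivative_works[symmetric])

lemma holo_on_complex_homogeneous: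
  "holo_on S f \<Longrightarrow> z \<in> S \<Longrightarrow> complex_homogeneous (frechet_derivative f (at z))"
  by (simp add: holo_on_iff_frechet_derivative)

lemma holo_on_subset: "holo_on S f \<Longrightarrow> T \<subseteq> S \<Longrightarrow> holo_on T f"
  unfolding holo_on_def by blast

lemma holo_on_imp_continuous_on: "holo_on S f \<Longrightarrow> continuous_on S f"
  by (intro continuous_at_imp_continuous_on ballI)
    (rule has_derivative_continuous[OF holo_on_has_derivative])

lemma holo_on_add:
  assumes "holo_on S f" "holo_on S g"
  shows "holo_on S (\<lambda>z. f z + g z)"
proof (rule holo_onI)
  fix z assume "z \<in> S"
  then show "((\<lambda>z. f z + g z) has_derivative
      (\<lambda>v. frechet_derivative f (at z) v + frechet_derivative g (at z) v)) (at z)"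
    using assms by (intro derivative_intros holo_on_has_derivative)
  show "complex_homogeneous (\<lambda>v. frechet_derivative f (at z) v + frechet_derivative g (at z) v)"
    using holo_on_complex_homogeneous[OF assms(1) \<open>z \<in> S\<close>]
      holo_on_complex_homogeneous[OF assms(2) \<open>z \<in> S\<close>]
    by (simp add: complex_homogeneous_def distrib_left)
qed

lemma holo_on_scaleR:
  assumes "holo_on S f"
  shows "holo_on S (\<lambda>z. a *\<^sub>R f z)"
proof (rule holo_onI)
  fix z assume "z \<in> S"
  then show "((\<lambda>z. a *\<^sub>R f z) has_derivative (\<lambda>v. a *\<^sub>R frechet_derivative f (at z) v)) (at z)"
    using assms by (intro derivative_intros holo_on_has_derivative)
  show "complex_homogeneous (\<lambda>v. a *\<^sub>R frechet_derivative f (at z) v)"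
    using holo_on_complex_homogeneous[OF assms \<open>z \<in> S\<close>] by (simp add: complex_homogeneous_def)
qed

lemma holo_on_diff: "holo_on S f \<Longrightarrow> holo_on S g \<Longrightarrow> holo_on S (\<lambda>z. f z - g z)"
  using holo_on_add[of S f "\<lambda>z. (-1) *\<^sub>R g z"] holo_on_scaleR[of S g "-1"] by simp

lemma has_field_derivative_slice:
  fixes f :: "complex ^ 'n \<Rightarrow> complex"
  assumes "(f has_derivative L) (at (z + t *s v))" "complex_homogeneous L"
  shows "((\<lambda>t. f (z + t *s v)) has_field_derivative L v) (at t)"
proof -
  have "((\<lambda>t. z + t *s v) has_derivative (\<lambda>s. s *s v)) (at t)"
    using bounded_linear_imp_has_derivative[OF bounded_linear_vector_smult_left[of v]]
    by (auto intro!: derivative_eq_intros)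
  then have "((\<lambda>t. f (z + t *s v)) has_derivative (\<lambda>s. L (s *s v))) (at t)"
    using assms(1) by (rule has_derivative_compose)
  moreover have "(\<lambda>s. L (s *s v)) = (*) (L v)"
    using assms(2) by (auto simp: complex_homogeneous_def mult.commute)
  ultimately show ?thesis
    by (simp add: has_field_derivative_def)
qed

lemma holomorphic_on_slice:
  assumes "holo_on S f" "\<And>t. t \<in> T \<Longrightarrow> z + t *s v \<in> S"
  shows "(\<lambda>t. f (z + t *s v)) holomorphic_on T"
proof (rule holomorphic_onI)
  fix t assume "t \<in> T"
  then have "((\<lambda>t. f (z + t *s v)) has_field_derivative
      frechet_derivative f (at (z + t *s v)) v) (at t)"
    using assms
    by (intro has_field_derivative_slice holo_on_has_derivative holo_on_complex_homogeneous)
  then show "(\<lambda>t. f (z + t *s v)) field_differentiable (at t within T)"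
    using field_differentiable_at_within field_differentiable_def by blast
qed

lemma holo_on_frechet_derivative_le:
  fixes f :: "complex ^ 'n \<Rightarrow> complex"
  assumes holo: "holo_on (cball z r) f" and "0 < r"
    and bound: "\<And>w. w \<in> cball z r \<Longrightarrow> cmod (f w) \<le> B"
  shows "cmod (frechet_derivative f (at z) v) \<le> B / r * norm v"
proof (cases "v = 0")
  case True
  have "complex_homogeneous (frechet_derivative f (at z))"
    using holo \<open>0 < r\<close> by (intro holo_on_complex_homogeneous) auto
  then have "frechet_derivative f (at z) (0 *s 0) = 0"
    unfolding complex_homogeneous_def by (metis mult_zero_left)
  then show ?thesis using True by simp
next
  case False
  define \<rho> where "\<rho> = r / norm v"
  have "\<rho> > 0" using False \<open>0 < r\<close> by (simp add: \<rho>_def)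
  have in_cball: "z + t *s v \<in> cball z r" if "t \<in> cball 0 \<rho>" for t
    using that False by (simp add: dist_norm norm_vector_smult \<rho>_def field_simps)
  let ?g = "\<lambda>t. f (z + t *s v)"
  have hol: "?g holomorphic_on cball 0 \<rho>"
    using holo in_cball by (rule holomorphic_on_slice)
  have "cmod ((deriv ^^ 1) ?g 0) \<le> fact 1 * B / \<rho> ^ 1"
  proof (rule Cauchy_inequality)
    show "?g holomorphic_on ball 0 \<rho>"
      using hol holomorphic_on_subset ball_subset_cball by blast
    show "continuous_on (cball 0 \<rho>) ?g"
      using hol by (rule holomorphic_on_imp_continuous_on)
    show "cmod (?g t) \<le> B" if "cmod (0 - t) = \<rho>" for t
      using that by (intro bound in_cball) auto
  qed fact
  moreover have "deriv ?g 0 = frechet_derivative f (at z) v"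
    using holo_on_has_derivative[OF holo] holo_on_complex_homogeneous[OF holo] \<open>0 < r\<close>
    by (intro DERIV_imp_deriv has_field_derivative_slice) auto
  ultimately show ?thesis
    by (simp add: \<rho>_def mult_ac)
qed

lemma holo_on_imp_lipschitz_on:
  fixes f :: "complex ^ 'n \<Rightarrow> complex"
  assumes holo: "holo_on S f" and "convex K" "0 < r" "0 \<le> B"
    and sub: "\<And>w. w \<in> K \<Longrightarrow> cball w r \<subseteq> S" and bound: "\<And>w. w \<in> S \<Longrightarrow> cmod (f w) \<le> B"
  shows "(B / r)-lipschitz_on K f"
proof (rule bounded_derivative_imp_lipschitz)
  fix w assume "w \<in> K"
  then have "cball w r \<subseteq> S" by (rule sub)
  then have "w \<in> S" using \<open>0 < r\<close> centre_in_cball by (meson less_imp_le subsetD)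
  then show "(f has_derivative frechet_derivative f (at w)) (at w within K)"
    by (rule has_derivative_at_withinI[OF holo_on_has_derivative[OF holo]])
  show "onorm (frechet_derivative f (at w)) \<le> B / r"
  proof (intro onorm_le holo_on_frechet_derivative_le)
    show "holo_on (cball w r) f" using holo \<open>cball w r \<subseteq> S\<close> by (rule holo_on_subset)
    show "cmod (f x) \<le> B" if "x \<in> cball w r" for x
      using \<open>cball w r \<subseteq> S\<close> that by (intro bound) blast
  qed fact
qed (use \<open>convex K\<close> \<open>0 < r\<close> \<open>0 \<le> B\<close> in simp_all)

lemma cball_half_subset:
  fixes w z :: "'a :: metric_space"
  assumes "w \<in> cball z (r / 2)"
  shows "cball w (r / 2) \<subseteq> cball z r"
proof
  fix x assume "x \<in> cball w (r / 2)"
  with assms show "x \<in> cball z r" using dist_triangle[of z x w] by simp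
qed

lemma holo_on_locally_lipschitz:
  fixes f :: "complex ^ 'n \<Rightarrow> complex"
  assumes holo: "holo_on S f" and "open S" "z \<in> S"
  obtains r B where "r > 0" "cball z r \<subseteq> S" "\<And>w. w \<in> cball z r \<Longrightarrow> cmod (f w) \<le> B"
    "B-lipschitz_on (cball z r) f"
proof -
  obtain r where r: "r > 0" "cball z r \<subseteq> S"
    using \<open>open S\<close> \<open>z \<in> S\<close> open_contains_cball by blast
  have "bounded (f ` cball z r)"
    using holo_on_imp_continuous_on[OF holo_on_subset[OF holo r(2)]]
    by (intro compact_imp_bounded compact_continuous_image compact_cball)
  then obtain B where "B > 0" and B: "\<And>w. w \<in> cball z r \<Longrightarrow> cmod (f w) \<le> B"
    by (auto simp: bounded_pos)
  have "(B / (r / 2))-lipschitz_on (cball z (r / 2)) f"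
    using r \<open>B > 0\<close> B holo_on_subset[OF holo r(2)]
    by (intro holo_on_imp_lipschitz_on[of "cball z r"] cball_half_subset) auto
  then have "(max B (2 * B / r))-lipschitz_on (cball z (r / 2)) f"
    by (rule lipschitz_on_le) (simp add: mult.commute)
  moreover have "cball z (r / 2) \<subseteq> cball z r"
    using r(1) by auto
  ultimately show ?thesis
    using r B by (intro that[of "r / 2" "max B (2 * B / r)"]) (auto simp: le_max_iff_disj)
qed

lemma has_derivative_Blinfun_apply: "(f has_derivative L) F \<Longrightarrow> blinfun_apply (Blinfun L) = L"
  by (simp add: bounded_linear_Blinfun_apply has_derivative_bounded_linear)

lemma uniformly_Cauchy_on_frechet_derivative:
  fixes f :: "nat \<Rightarrow> complex ^ 'n \<Rightarrow> complex"
  assumes holo: "\<And>n. holo_on S (f n)" and Cauchy: "uniformly_Cauchy_on S f"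
    and "r > 0" and sub: "\<And>w. w \<in> K \<Longrightarrow> cball w r \<subseteq> S"
  shows "uniformly_Cauchy_on K (\<lambda>n w. Blinfun (frechet_derivative (f n) (at w)))"
proof (rule uniformly_Cauchy_onI)
  fix e :: real assume "e > 0"
  let ?D = "\<lambda>n w. frechet_derivative (f n) (at w)"
  have "e * r / 2 > 0" using \<open>e > 0\<close> \<open>r > 0\<close> by simp
  then obtain N where N: "\<And>x m n. x \<in> S \<Longrightarrow> m \<ge> N \<Longrightarrow> n \<ge> N \<Longrightarrow> cmod (f m x - f n x) < e * r / 2"
    using Cauchy unfolding uniformly_Cauchy_on_def dist_norm by blast
  have "dist (Blinfun (?D m w)) (Blinfun (?D n w)) < e" if "w \<in> K" "m \<ge> N" "n \<ge> N" for w m n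
  proof -
    have "w \<in> S"
      using sub[OF \<open>w \<in> K\<close>] \<open>r > 0\<close> centre_in_cball by (meson less_imp_le subsetD)
    then have der: "(f k has_derivative ?D k w) (at w)" for k
      using holo by (intro holo_on_has_derivative)
    have "frechet_derivative (\<lambda>x. f m x - f n x) (at w) = (\<lambda>v. ?D m w v - ?D n w v)"
      using has_derivative_diff[OF der der] by (rule frechet_derivative_at[symmetric])
    moreover have
      "cmod (frechet_derivative (\<lambda>x. f m x - f n x) (at w) v) \<le> e * r / 2 / r * norm v" for v
    proof (rule holo_on_frechet_derivative_le)
      show "holo_on (cball w r) (\<lambda>x. f m x - f n x)"
        using holo_on_diff[OF holo holo] sub[OF \<open>w \<in> K\<close>] by (rule holo_on_subset)
      show "cmod (f m x - f n x) \<le> e * r / 2" if "x \<in> cball w r" for x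
        using sub[OF \<open>w \<in> K\<close>] that N[OF _ \<open>m \<ge> N\<close> \<open>n \<ge> N\<close>] by (meson less_imp_le subsetD)
    qed fact
    ultimately have "dist (Blinfun (?D m w)) (Blinfun (?D n w)) \<le> e / 2"
      using \<open>e > 0\<close> \<open>r > 0\<close> unfolding dist_norm
      by (intro norm_blinfun_bound)
        (auto simp: blinfun.diff_left has_derivative_Blinfun_apply[OF der])
    then show ?thesis using \<open>e > 0\<close> by linarith
  qed
  then show "\<exists>N. \<forall>w\<in>K. \<forall>m\<ge>N. \<forall>n\<ge>N. dist (Blinfun (?D m w)) (Blinfun (?D n w)) < e"
    by blast
qed

lemma uniform_limit_Blinfun_imp_eventually_le:
  assumes linear: "\<And>n w. w \<in> K \<Longrightarrow> bounded_linear (f' n w)"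
    and lim: "uniform_limit K (\<lambda>n w. Blinfun (f' n w)) D F" and "e > 0"
  shows "\<forall>\<^sub>F n in F. \<forall>w\<in>K. \<forall>v. norm (f' n w v - D w v) \<le> e * norm v"
  using uniform_limitD[OF lim \<open>e > 0\<close>]
proof eventually_elim
  case (elim n)
  have "norm (f' n w v - D w v) \<le> e * norm v" if "w \<in> K" for w v
  proof -
    have "f' n w v - D w v = (Blinfun (f' n w) - D w) v"
      by (simp add: blinfun.diff_left bounded_linear_Blinfun_apply[OF linear[OF that]])
    also have "norm \<dots> \<le> norm (Blinfun (f' n w) - D w) * norm v"
      by (rule norm_blinfun)
    also have "\<dots> \<le> e * norm v"
      using elim that by (intro mult_right_mono) (auto simp: dist_norm intro: less_imp_le)
    finally show ?thesis .
  qed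
  then show ?case by blast
qed

lemma has_derivative_uniformly_Cauchy_limit:
  fixes f :: "nat \<Rightarrow> 'a::real_normed_vector \<Rightarrow> 'b::banach"
  assumes K: "open K" "convex K" "z \<in> K"
    and der: "\<And>n w. w \<in> K \<Longrightarrow> (f n has_derivative f' n w) (at w)"
    and Cauchy: "uniformly_Cauchy_on K (\<lambda>n w. Blinfun (f' n w))"
    and lim: "\<And>w. w \<in> K \<Longrightarrow> (\<lambda>n. f n w) \<longlonglongrightarrow> g w"
  obtains L where "(g has_derivative L) (at z)" "\<And>v. (\<lambda>n. f' n z v) \<longlonglongrightarrow> L v"
proof -
  obtain D where D: "uniform_limit K (\<lambda>n w. Blinfun (f' n w)) D sequentially"
    using Cauchy_uniformly_convergent[OF Cauchy] uniformly_convergent_on_def by blast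
  have "\<exists>G. \<forall>w\<in>K. (\<lambda>n. f n w) \<longlonglongrightarrow> G w \<and> (G has_derivative D w) (at w within K)"
  proof (rule has_derivative_sequence)
    show "(f n has_derivative f' n w) (at w within K)" if "w \<in> K" for n w
      using der[OF that] by (rule has_derivative_at_withinI)
    show "\<forall>\<^sub>F n in sequentially. \<forall>w\<in>K. \<forall>v. norm (f' n w v - D w v) \<le> e * norm v" if "e > 0" for e
      using has_derivative_bounded_linear[OF der] D that
      by (rule uniform_limit_Blinfun_imp_eventually_le)
    show "(\<lambda>n. f n z) \<longlonglongrightarrow> g z" using K(3) by (rule lim)
  qed (use K in auto)
  then obtain G where G: "\<And>w. w \<in> K \<Longrightarrow> (\<lambda>n. f n w) \<longlonglongrightarrow> G w"
    "(G has_derivative D z) (at z within K)"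
    using K(3) by blast
  have "G w = g w" if "w \<in> K" for w
    using G(1) lim that LIMSEQ_unique by blast
  then have "(g has_derivative D z) (at z)"
    using has_derivative_transform_within_open[of G "D z" z UNIV K g] G(2) K
    by (simp add: at_within_open[OF K(3,1)])
  moreover have "(\<lambda>n. f' n z v) \<longlonglongrightarrow> D z v" for v
    using blinfun.tendsto[OF tendsto_uniform_limitI[OF D K(3)] tendsto_const, of v]
    by (simp add: has_derivative_Blinfun_apply[OF der[OF K(3)]])
  ultimately show ?thesis by (rule that)
qed

lemma complex_homogeneous_LIMSEQ:
  assumes "\<And>n. complex_homogeneous (L n)" "\<And>v. (\<lambda>n. L n v) \<longlonglongrightarrow> M v"
  shows "complex_homogeneous M"
  unfolding complex_homogeneous_def
proof (intro allI LIMSEQ_unique)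
  fix c v
  show "(\<lambda>n. L n (c *s v)) \<longlonglongrightarrow> M (c *s v)" by (rule assms(2))
  have "(\<lambda>n. c * L n v) \<longlonglongrightarrow> c * M v" by (intro tendsto_mult_left assms(2))
  then show "(\<lambda>n. L n (c *s v)) \<longlonglongrightarrow> c * M v"
    using assms(1) by (simp add: complex_homogeneous_def)
qed

lemma holo_on_uniform_sequence:
  fixes f :: "nat \<Rightarrow> complex ^ 'n \<Rightarrow> complex"
  assumes holo: "\<And>n. holo_on S (f n)"
    and lim: "\<And>z. z \<in> S \<Longrightarrow> \<exists>r>0. cball z r \<subseteq> S \<and> uniform_limit (cball z r) f g sequentially"
  shows "holo_on S g"
proof -
  have "\<exists>L. (g has_derivative L) (at z) \<and> complex_homogeneous L" if "z \<in> S" for z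
  proof -
    obtain r where r: "r > 0" "cball z r \<subseteq> S" "uniform_limit (cball z r) f g sequentially"
      using lim \<open>z \<in> S\<close> by blast
    let ?K = "ball z (r / 2)" and ?f' = "\<lambda>n w. frechet_derivative (f n) (at w)"
    have K: "?K \<subseteq> cball z r" using r(1) by auto
    have "uniformly_Cauchy_on ?K (\<lambda>n w. Blinfun (?f' n w))"
    proof (rule uniformly_Cauchy_on_frechet_derivative)
      show "uniformly_Cauchy_on (cball z r) f"
        using r(3) by (intro uniformly_convergent_Cauchy) (auto simp: uniformly_convergent_on_def)
      show "cball w (r / 2) \<subseteq> cball z r" if "w \<in> ?K" for w
        using that by (intro cball_half_subset) auto
    qed (use r holo_on_subset[OF holo r(2)] in auto)
    moreover have "(f n has_derivative ?f' n w) (at w)" if "w \<in> ?K" for n w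
      using that K r(2) by (intro holo_on_has_derivative[OF holo]) blast
    moreover have "(\<lambda>n. f n w) \<longlonglongrightarrow> g w" if "w \<in> ?K" for w
      using that K tendsto_uniform_limitI[OF r(3)] by blast
    ultimately obtain L where L: "(g has_derivative L) (at z)" "\<And>v. (\<lambda>n. ?f' n z v) \<longlonglongrightarrow> L v"
      using has_derivative_uniformly_Cauchy_limit[of ?K z f ?f' g] r(1)
      by (metis open_ball convex_ball centre_in_ball half_gt_zero)
    have "complex_homogeneous L"
      by (rule complex_homogeneous_LIMSEQ[OF holo_on_complex_homogeneous[OF holo \<open>z \<in> S\<close>] L(2)])
    then show ?thesis using L(1) by blast
  qed
  then show ?thesis by (simp add: holo_on_def complex_homogeneous_def)
qed

lemma holo_on_identity_convex:
  assumes holo: "holo_on S f" "holo_on S g" and S: "open S" "convex S"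
    and "a \<in> S" "\<forall>\<^sub>F z in nhds a. f z = g z" and "w \<in> S"
  shows "f w = g w"
proof -
  let ?\<gamma> = "\<lambda>t. a + t *s (w - a)"
  obtain V where V: "open V" "a \<in> V" "\<And>z. z \<in> V \<Longrightarrow> f z = g z"
    using assms(6) by (auto simp: eventually_nhds)
  have cont: "continuous_on UNIV ?\<gamma>"
    by (intro continuous_intros linear_continuous_on bounded_linear_vector_smult_left)
  have "f (?\<gamma> 1) = g (?\<gamma> 1)"
  proof (rule analytic_continuation_open
      [of "?\<gamma> -` (V \<inter> S)" "?\<gamma> -` S" "\<lambda>t. f (?\<gamma> t)" "\<lambda>t. g (?\<gamma> t)"])
    show "open (?\<gamma> -` (V \<inter> S))" "open (?\<gamma> -` S)"
      using cont V(1) S(1) by (auto intro!: open_vimage open_Int)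
    have "0 \<in> ?\<gamma> -` (V \<inter> S)" using V(2) \<open>a \<in> S\<close> by simp
    then show "?\<gamma> -` (V \<inter> S) \<noteq> {}" by blast
    have "?\<gamma> -` S = (\<lambda>t. t *s (w - a)) -` ((+) (- a) ` S)"
      by (force simp: image_iff algebra_simps)
    also have "convex \<dots>"
      using S(2) by (intro convex_linear_vimage convex_translation bounded_linear.linear
          bounded_linear_vector_smult_left)
    finally show "connected (?\<gamma> -` S)" by (rule convex_connected)
    show "(\<lambda>t. f (?\<gamma> t)) holomorphic_on ?\<gamma> -` S" "(\<lambda>t. g (?\<gamma> t)) holomorphic_on ?\<gamma> -` S"
      by (rule holomorphic_on_slice[OF holo(1)] holomorphic_on_slice[OF holo(2)], simp)+
  qed (use V(3) \<open>w \<in> S\<close> in auto)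
  then show ?thesis by simp
qed

lemma holo_on_identity:
  assumes holo: "holo_on S f" "holo_on S g" and S: "open S" "connected S"
    and "a \<in> S" "\<forall>\<^sub>F z in nhds a. f z = g z" and "w \<in> S"
  shows "f w = g w"
proof -
  have "\<forall>\<^sub>F z in nhds w. f z = g z"
  proof (rule connected_induction_simple
      [where P = "\<lambda>x. \<forall>\<^sub>F z in nhds x. f z = g z", OF S(2) assms(5,7,6)])
    fix b assume "b \<in> S"
    then obtain r where r: "r > 0" "ball b r \<subseteq> S" using S(1) openE by blast
    have "\<forall>\<^sub>F z in nhds y. f z = g z"
      if "x \<in> ball b r" "\<forall>\<^sub>F z in nhds x. f z = g z" "y \<in> ball b r" for x y
    proof -
      have "f z = g z" if "z \<in> ball b r" for z
        using holo r(2) \<open>x \<in> ball b r\<close> \<open>\<forall>\<^sub>F z in nhds x. f z = g z\<close> that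
        by (intro holo_on_identity_convex[of "ball b r" f g x]) (auto intro: holo_on_subset)
      then show ?thesis using open_ball \<open>y \<in> ball b r\<close> unfolding eventually_nhds by blast
    qed
    moreover have "openin (top_of_set S) (ball b r)" "b \<in> ball b r"
      using r by (simp_all add: open_subset)
    ultimately show "\<exists>T. openin (top_of_set S) T \<and> b \<in> T \<and>
        (\<forall>x\<in>T. \<forall>y\<in>T. (\<forall>\<^sub>F z in nhds x. f z = g z) \<longrightarrow> (\<forall>\<^sub>F z in nhds y. f z = g z))"
      by (intro exI[of _ "ball b r"] conjI ballI impI)
  qed
  then show ?thesis by (rule eventually_nhds_x_imp_x)
qed

section \<open>The mean value inequality\<close>

lemma nn_integral_lborel_translate:
  fixes c :: "'a::euclidean_space"
  assumes [measurable]: "h \<in> borel_measurable borel"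
  shows "(\<integral>\<^sup>+x. h (c + x) \<partial>lborel) = (\<integral>\<^sup>+x. h x \<partial>lborel)"
  using nn_integral_distr[of "(+) c" lborel borel h] by (simp add: lborel_distr_plus)

text \<open>Both sides are \<open>\<integral>\<integral> indicator A (x + y) * indicator B y\<close>, integrated in either order.\<close>

lemma emeasure_translation_invariant:
  fixes M :: "'a::euclidean_space measure"
  assumes "sigma_finite_measure M" and [measurable_cong]: "sets M = sets borel"
    and invariant: "\<And>y. distr M borel (\<lambda>x. x + y) = M"
    and [measurable]: "A \<in> sets borel" "B \<in> sets borel"
  shows "emeasure M A * emeasure lborel B = emeasure lborel A * emeasure M (uminus -` B)"
proof -
  interpret M: sigma_finite_measure M by fact
  interpret pair_sigma_finite lborel M ..
  have [measurable]: "uminus -` B \<in> sets borel"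
    using measurable_sets[of uminus borel borel B] by simp
  have translate_M: "(\<integral>\<^sup>+x. g (x + y) \<partial>M) = (\<integral>\<^sup>+x. g x \<partial>M)"
    if [measurable]: "g \<in> borel_measurable borel" for g :: "'a \<Rightarrow> ennreal" and y
    using nn_integral_distr[of "\<lambda>x. x + y" M borel g] by (simp add: invariant)
  have "emeasure M A * emeasure lborel B = (\<integral>\<^sup>+y. emeasure M A * indicator B y \<partial>lborel)"
    by (simp add: nn_integral_cmult)
  also have "\<dots> = (\<integral>\<^sup>+y. (\<integral>\<^sup>+x. indicator A (x + y) * indicator B y \<partial>M) \<partial>lborel)"
    using translate_M[of "indicator A"] by (simp add: nn_integral_multc)
  also have "\<dots> = (\<integral>\<^sup>+x. (\<integral>\<^sup>+y. indicator A (x + y) * indicator B (x + y - x) \<partial>lborel) \<partial>M)"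
    by (subst Fubini') simp_all
  also have "\<dots> = (\<integral>\<^sup>+x. (\<integral>\<^sup>+y. indicator A y * indicator B (y - x) \<partial>lborel) \<partial>M)"
    using nn_integral_lborel_translate[of "\<lambda>y. indicator A y * indicator B (y - x)" x for x]
    by simp
  also have "\<dots> = (\<integral>\<^sup>+y. (\<integral>\<^sup>+x. indicator A y * indicator (uminus -` B) (x + (- y)) \<partial>M) \<partial>lborel)"
    by (subst Fubini') (simp_all add: indicator_def)
  also have "\<dots> = (\<integral>\<^sup>+y. indicator A y * emeasure M (uminus -` B) \<partial>lborel)"
    using translate_M[of "indicator (uminus -` B)" "- y" for y] by (simp add: nn_integral_cmult)
  also have "\<dots> = emeasure lborel A * emeasure M (uminus -` B)"
    by (simp add: nn_integral_multc)
  finally show ?thesis .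
qed

lemma borel_measurable_orthogonal_transformation:
  fixes T :: "'a::euclidean_space \<Rightarrow> 'a"
  assumes "orthogonal_transformation T"
  shows "T \<in> borel_measurable borel"
  using orthogonal_transformation_linear[OF assms]
  by (simp add: borel_measurable_continuous_onI linear_continuous_on linear_conv_bounded_linear)

lemma lborel_distr_orthogonal_transformation:
  fixes T :: "'a::euclidean_space \<Rightarrow> 'a"
  assumes T: "orthogonal_transformation T"
  shows "distr lborel borel T = lborel"
proof -
  let ?M = "distr lborel borel T"
  note [measurable] = borel_measurable_orthogonal_transformation[OF T]
  have "T -` ball 0 r = ball 0 r" for r
    using orthogonal_transformation_norm[OF T] by auto
  then have emeasure_ball: "emeasure ?M (ball 0 r) = emeasure lborel (ball 0 r :: 'a set)" for r
    by (simp add: emeasure_distr)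
  have sigma_finite: "sigma_finite_measure ?M"
  proof
    show "\<exists>A. countable A \<and> A \<subseteq> sets ?M \<and> \<Union>A = space ?M \<and> (\<forall>a\<in>A. emeasure ?M a \<noteq> \<infinity>)"
      using emeasure_lborel_ball_finite[of "0::'a"]
      by (intro exI[of _ "range (\<lambda>n::nat. ball 0 (real n))"])
        (auto simp: emeasure_ball reals_Archimedean2 less_top)
  qed
  have invariant: "distr ?M borel (\<lambda>x. x + y) = ?M" for y
  proof -
    obtain u where u: "y = T u" using orthogonal_transformation_surj[OF T] by (metis surj_def)
    have "distr ?M borel (\<lambda>x. x + y) = distr lborel borel (\<lambda>x. T (u + x))"
      using linear_add[OF orthogonal_transformation_linear[OF T]]
      by (simp add: distr_distr o_def u add.commute)
    also have "\<dots> = distr (distr lborel borel ((+) u)) borel T"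
      by (simp add: distr_distr o_def)
    finally show ?thesis by (simp add: lborel_distr_plus)
  qed
  let ?B = "ball 0 1 :: 'a set"
  have "uminus -` ?B = ?B" by auto
  then have "emeasure ?M A * emeasure lborel ?B = emeasure lborel A * emeasure lborel ?B"
    if "A \<in> sets borel" for A
    using emeasure_translation_invariant[OF sigma_finite _ invariant that, of ?B]
    by (simp add: emeasure_ball)
  moreover have "emeasure lborel ?B \<noteq> 0" "emeasure lborel ?B \<noteq> \<infinity>"
    using emeasure_lborel_ball_finite[of "0::'a" 1] content_ball_pos[of 1 "0::'a"]
    by (auto simp: measure_def)
  ultimately have "emeasure ?M A = emeasure lborel A" if "A \<in> sets borel" for A
    using that ennreal_mult_cancel_left[of "emeasure lborel ?B"]
    by (metis mult.commute infinity_ennreal_def)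
  then show ?thesis by (intro measure_eqI) auto
qed

lemma nn_integral_lborel_orthogonal_transformation:
  fixes T :: "'a::euclidean_space \<Rightarrow> 'a"
  assumes T: "orthogonal_transformation T" and [measurable]: "h \<in> borel_measurable borel"
  shows "(\<integral>\<^sup>+x. h (T x) \<partial>lborel) = (\<integral>\<^sup>+x. h x \<partial>lborel)"
proof -
  note [measurable] = borel_measurable_orthogonal_transformation[OF T]
  show ?thesis
    using nn_integral_distr[of T lborel borel h] lborel_distr_orthogonal_transformation[OF T]
    by simp
qed

lemma orthogonal_transformation_cis_smult:
  "orthogonal_transformation (\<lambda>v :: complex ^ 'n. cis \<theta> *s v)"
  unfolding orthogonal_transformation
  by (auto intro!: linearI simp: norm_vector_smult vec_eq_iff algebra_simps)

lemma holo_on_mean_value_circle: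
  fixes f :: "complex ^ 'n \<Rightarrow> complex"
  assumes holo: "holo_on S f" and sub: "\<And>t. cmod t \<le> 1 \<Longrightarrow> z + t *s w \<in> S"
  shows "((\<lambda>t. f (z + cis (2 * pi * t) *s w)) has_integral f z) {0..1}"
proof -
  let ?g = "\<lambda>t. f (z + t *s w)"
  have hol: "?g holomorphic_on cball 0 1"
    using holo sub by (intro holomorphic_on_slice) auto
  have "((\<lambda>u. ?g u / (u - 0)) has_contour_integral (2 * of_real pi * \<i>) * ?g 0) (circlepath 0 1)"
    using hol by (intro Cauchy_integral_circlepath)
      (auto intro: holomorphic_on_subset holomorphic_on_imp_continuous_on)
  then have "((\<lambda>t. (2 * of_real pi * \<i>) * ?g (cis (2 * pi * t))) has_integral
      (2 * of_real pi * \<i>) * ?g 0) {0..1}"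
    unfolding has_contour_integral
    by (rule has_integral_spike_eq[THEN iffD1, rotated 2])
       (auto simp: vector_derivative_circlepath, auto simp: circlepath cis_conv_exp mult_ac)
  then show ?thesis
    using has_integral_mult_right[of "\<lambda>t. (2 * of_real pi * \<i>) * ?g (cis (2 * pi * t))"
        "(2 * of_real pi * \<i>) * ?g 0" "{0..1}" "1 / (2 * of_real pi * \<i>)"] by simp
qed

lemma holo_on_sub_mean_value_circle:
  fixes f :: "complex ^ 'n \<Rightarrow> complex"
  assumes holo: "holo_on S f" and sub: "\<And>t. cmod t \<le> 1 \<Longrightarrow> z + t *s w \<in> S"
  shows "ennreal (cmod (f z))
    \<le> (\<integral>\<^sup>+t\<in>{0..1}. ennreal (cmod (f (z + cis (2 * pi * t) *s w))) \<partial>lborel)"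
proof -
  let ?g = "\<lambda>t. f (z + cis (2 * pi * t) *s w)"
  have "continuous_on {0..1} ?g"
  proof (rule continuous_on_compose2[OF holo_on_imp_continuous_on[OF holo]])
    show "continuous_on {0..1} (\<lambda>t. z + cis (2 * pi * t) *s w)"
      by (intro continuous_intros continuous_on_compose2[OF linear_continuous_on[OF
          bounded_linear_vector_smult_left]]) auto
  qed (use sub in auto)
  then have norm_integrable: "(\<lambda>t. cmod (?g t)) integrable_on {0..1}"
    by (intro integrable_continuous_real continuous_intros)
  have mean: "(?g has_integral f z) {0..1}"
    using holo sub by (rule holo_on_mean_value_circle)
  have "cmod (f z) \<le> integral {0..1} (\<lambda>t. cmod (?g t))"
    using integral_norm_bound_integral[OF has_integral_integrable[OF mean] norm_integrable]
      integral_unique[OF mean] by simp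
  also have "ennreal \<dots> = (\<integral>\<^sup>+t\<in>{0..1}. ennreal (cmod (?g t)) \<partial>lborel)"
    by (rule nn_integral_has_integral_lebesgue'[symmetric])
      (auto intro: integrable_integral norm_integrable)
  finally show ?thesis by (simp add: ennreal_leI)
qed

lemma borel_measurable_add_cis_smult:
  "(\<lambda>(w, t). z + cis (2 * pi * t) *s w) \<in> borel_measurable (borel \<Otimes>\<^sub>M borel)"
proof -
  have "(\<lambda>(w, t). z + cis (2 * pi * t) *s w)
      = (\<lambda>p. \<chi> i. z $ i + cis (2 * pi * snd p) * fst p $ i)"
    by (auto simp: vec_eq_iff)
  then show ?thesis
    unfolding borel_prod
    by (simp only:) (rule borel_measurable_continuous_onI, intro continuous_intros)
qed

text \<open>The mean value inequality on the circles \<open>z + cis \<theta> *s w\<close> is averaged over \<open>w\<close>; for each \<open>\<theta>\<close>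
  the rotation \<open>cis \<theta>\<close> preserves the average over the ball.\<close>

lemma holo_on_sub_mean_value_ball:
  fixes f :: "complex ^ 'n \<Rightarrow> complex"
  assumes holo: "holo_on (ball z r) f"
  shows "ennreal (cmod (f z)) * emeasure lborel (ball z r)
     \<le> (\<integral>\<^sup>+x\<in>ball z r. ennreal (cmod (f x)) \<partial>lborel)"
proof -
  have [measurable]: "ball z r \<in> sets borel" by simp
  define h where "h = (\<lambda>x. ennreal (cmod (f x)) * indicator (ball z r) x)"
  have [measurable]: "h \<in> borel_measurable borel"
    unfolding h_def using holo_on_imp_continuous_on[OF holo]
    by (subst borel_measurable_restrict_space_iff_ennreal[symmetric])
      (auto intro!: borel_measurable_continuous_on_restrict continuous_intros measurable_ennreal)
  note [measurable] = borel_measurable_add_cis_smult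
  have circle: "ennreal (cmod (f z)) * indicator (ball z r) (z + w)
      \<le> (\<integral>\<^sup>+t\<in>{0..1}. h (z + cis (2 * pi * t) *s w) \<partial>lborel)" for w
  proof (cases "norm w < r")
    case True
    then have "z + t *s w \<in> ball z r" if "cmod t \<le> 1" for t
      using mult_right_mono[OF that norm_ge_zero, of w] by (simp add: dist_norm norm_vector_smult)
    moreover from this[of 1] have "z + w \<in> ball z r" by simp
    ultimately show ?thesis
      using holo_on_sub_mean_value_circle[OF holo, of z w] by (simp add: h_def)
  qed (simp add: dist_norm)
  have rotation: "(\<integral>\<^sup>+w. h (z + cis (2 * pi * t) *s w) \<partial>lborel) = (\<integral>\<^sup>+x. h x \<partial>lborel)" for t
    using nn_integral_lborel_orthogonal_transformation[OF orthogonal_transformation_cis_smult,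
        of "\<lambda>w. h (z + w)" "2 * pi * t"] by (simp add: nn_integral_lborel_translate)
  have "ennreal (cmod (f z)) * emeasure lborel (ball z r)
      = (\<integral>\<^sup>+x. ennreal (cmod (f z)) * indicator (ball z r) x \<partial>lborel)"
    by (simp add: nn_integral_cmult_indicator)
  also have "\<dots> = (\<integral>\<^sup>+w. ennreal (cmod (f z)) * indicator (ball z r) (z + w) \<partial>lborel)"
    by (rule nn_integral_lborel_translate[symmetric]) measurable
  also have "\<dots> \<le> (\<integral>\<^sup>+w. (\<integral>\<^sup>+t\<in>{0..1}. h (z + cis (2 * pi * t) *s w) \<partial>lborel) \<partial>lborel)"
    by (intro nn_integral_mono circle)
  also have "\<dots> = (\<integral>\<^sup>+t. (\<integral>\<^sup>+w. h (z + cis (2 * pi * t) *s w) * indicator {0..1} t \<partial>lborel) \<partial>lborel)"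
    by (intro lborel_pair.Fubini') measurable
  also have "\<dots> = (\<integral>\<^sup>+t. (\<integral>\<^sup>+x. h x \<partial>lborel) * indicator {0..1 :: real} t \<partial>lborel)"
    using borel_measurable_add_cis_smult
    by (intro nn_integral_cong) (simp add: nn_integral_multc rotation)
  also have "\<dots> = (\<integral>\<^sup>+x. h x \<partial>lborel)"
    by (simp add: nn_integral_cmult)
  finally show ?thesis unfolding h_def .
qed

section \<open>$L^p$ seminorms\<close>

definition Lp_integral :: "real \<Rightarrow> 'a measure \<Rightarrow> ('a \<Rightarrow> 'b::real_normed_vector) \<Rightarrow> ennreal" where
  "Lp_integral p M f = (\<integral>\<^sup>+x. ennreal (norm (f x) powr p) \<partial>M)"

definition Lp_seminorm :: "real \<Rightarrow> 'a measure \<Rightarrow> ('a \<Rightarrow> 'b::real_normed_vector) \<Rightarrow> real" where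
  "Lp_seminorm p M f = enn2real (Lp_integral p M f) powr (1 / p)"

definition Lp_space :: "real \<Rightarrow> 'a measure \<Rightarrow> ('a \<Rightarrow> 'b::real_normed_vector) set" where
  "Lp_space p M = {f \<in> borel_measurable M. Lp_integral p M f < \<infinity>}"

lemma Lp_spaceD:
  assumes "f \<in> Lp_space p M"
  shows "f \<in> borel_measurable M" "Lp_integral p M f < \<infinity>"
  using assms by (auto simp: Lp_space_def)

lemma Lp_seminorm_nonneg: "0 \<le> Lp_seminorm p M f"
  by (simp add: Lp_seminorm_def)

lemma Lp_seminorm_zero: "Lp_seminorm p M (\<lambda>x. 0) = 0"
  by (simp add: Lp_seminorm_def Lp_integral_def)

lemma Lp_seminorm_minus_commute:
  "Lp_seminorm p M (\<lambda>x. f x - g x) = Lp_seminorm p M (\<lambda>x. g x - f x)"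
  by (simp add: Lp_seminorm_def Lp_integral_def norm_minus_commute)

lemma Lp_integral_eq_seminorm_powr:
  assumes "p > 0" "f \<in> Lp_space p M"
  shows "Lp_integral p M f = ennreal (Lp_seminorm p M f powr p)"
  using assms by (simp add: Lp_seminorm_def Lp_space_def powr_powr)

lemma Lp_integral_le_powr:
  assumes "p > 0" "f \<in> Lp_space p M" "Lp_seminorm p M f \<le> b"
  shows "Lp_integral p M f \<le> ennreal (b powr p)"
  using assms
  by (auto simp: Lp_integral_eq_seminorm_powr Lp_seminorm_nonneg intro!: ennreal_leI powr_mono2)

lemma Lp_seminorm_le:
  assumes "p > 0" "b \<ge> 0" "Lp_integral p M f \<le> ennreal (b powr p)"
  shows "Lp_seminorm p M f \<le> b"
proof -
  have "enn2real (Lp_integral p M f) \<le> b powr p"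
    using assms(3) by (intro enn2real_leI) auto
  then have "Lp_seminorm p M f \<le> (b powr p) powr (1 / p)"
    unfolding Lp_seminorm_def using assms(1) by (intro powr_mono2) auto
  then show ?thesis using assms by (simp add: powr_powr)
qed

lemma Lp_integral_scaleR:
  assumes [measurable]: "f \<in> borel_measurable M"
  shows "Lp_integral p M (\<lambda>x. c *\<^sub>R f x) = ennreal (\<bar>c\<bar> powr p) * Lp_integral p M f"
  unfolding Lp_integral_def
  by (subst nn_integral_cmult[symmetric]) (auto simp: powr_mult ennreal_mult)

lemma Lp_seminorm_scaleR:
  assumes "p > 0" "f \<in> borel_measurable M"
  shows "Lp_seminorm p M (\<lambda>x. c *\<^sub>R f x) = \<bar>c\<bar> * Lp_seminorm p M f"
  using assms by (simp add: Lp_seminorm_def Lp_integral_scaleR enn2real_mult powr_mult powr_powr)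

lemma Lp_space_scaleR: "f \<in> Lp_space p M \<Longrightarrow> (\<lambda>x. c *\<^sub>R f x) \<in> Lp_space p M"
  by (auto simp: Lp_space_def Lp_integral_scaleR ennreal_mult_less_top)

lemma powr_convex_nonneg:
  assumes "p \<ge> 1"
  shows "convex_on {0..} (\<lambda>x::real. x powr p)"
proof (rule convex_onI)
  fix t x y :: real
  assume t: "0 < t" "t < 1" and xy: "x \<in> {0..}" "y \<in> {0..}"
  have scale: "(s * z) powr p \<le> s * z powr p" if "0 < s" "s < 1" "z \<ge> 0" for s z
    using that assms powr_mono'[of 1 p s] by (simp add: powr_mult mult_right_mono)
  consider "x = 0" | "y = 0" | (positive) "x > 0" "y > 0" using xy by force
  then show "((1 - t) *\<^sub>R x + t *\<^sub>R y) powr p \<le> (1 - t) * x powr p + t * y powr p"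
  proof cases
    case positive
    then show ?thesis using convex_onD[OF powr_convex[OF assms], of t x y] t by auto
  qed (use scale t xy assms in auto)
qed (simp add: convex_real_interval)

lemma norm_powr_convex:
  fixes x y :: "'a::real_normed_vector"
  assumes "p \<ge> 1" "u \<ge> 0" "v \<ge> 0" "u + v = 1"
  shows "norm (u *\<^sub>R x + v *\<^sub>R y) powr p \<le> u * norm x powr p + v * norm y powr p"
proof -
  have "norm (u *\<^sub>R x + v *\<^sub>R y) \<le> u * norm x + v * norm y"
    using assms by (metis abs_of_nonneg norm_scaleR norm_triangle_ineq)
  then have "norm (u *\<^sub>R x + v *\<^sub>R y) powr p \<le> (u * norm x + v * norm y) powr p"
    using assms by (intro powr_mono2) auto
  also have "\<dots> \<le> u * norm x powr p + v * norm y powr p"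
    using powr_convex_nonneg[OF assms(1)] assms by (auto simp: convex_on_def)
  finally show ?thesis .
qed

lemma Lp_integral_convex:
  fixes f g :: "'a \<Rightarrow> 'b::real_normed_vector"
  assumes "p \<ge> 1" "u \<ge> 0" "v \<ge> 0" "u + v = 1"
    and [measurable]: "f \<in> borel_measurable M" "g \<in> borel_measurable M"
  shows "Lp_integral p M (\<lambda>x. u *\<^sub>R f x + v *\<^sub>R g x)
    \<le> ennreal u * Lp_integral p M f + ennreal v * Lp_integral p M g"
proof -
  have "Lp_integral p M (\<lambda>x. u *\<^sub>R f x + v *\<^sub>R g x)
      \<le> (\<integral>\<^sup>+x. ennreal u * ennreal (norm (f x) powr p)
            + ennreal v * ennreal (norm (g x) powr p) \<partial>M)"
    unfolding Lp_integral_def using assms(2,3) norm_powr_convex[OF assms(1-4)]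
    by (intro nn_integral_mono)
      (simp add: ennreal_mult[symmetric] ennreal_plus[symmetric] ennreal_leI del: ennreal_plus)
  also have "\<dots> = ennreal u * Lp_integral p M f + ennreal v * Lp_integral p M g"
    by (simp add: Lp_integral_def nn_integral_add nn_integral_cmult)
  finally show ?thesis .
qed

lemma Lp_space_add:
  fixes f g :: "'a \<Rightarrow> 'b::{real_normed_vector, second_countable_topology}"
  assumes "p \<ge> 1" "f \<in> Lp_space p M" "g \<in> Lp_space p M"
  shows "(\<lambda>x. f x + g x) \<in> Lp_space p M"
proof -
  have "Lp_integral p M (\<lambda>x. (1/2) *\<^sub>R f x + (1/2) *\<^sub>R g x)
      \<le> ennreal (1/2) * Lp_integral p M f + ennreal (1/2) * Lp_integral p M g"
    using assms by (intro Lp_integral_convex Lp_spaceD) auto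
  also have "\<dots> < \<infinity>"
    using assms by (simp add: Lp_space_def ennreal_mult_eq_top_iff less_top[symmetric])
  finally have "(\<lambda>x. (1/2) *\<^sub>R f x + (1/2) *\<^sub>R g x) \<in> Lp_space p M"
    using assms by (auto simp: Lp_space_def)
  from Lp_space_scaleR[OF this, of 2] show ?thesis by (simp add: scaleR_add_right)
qed

lemma Lp_space_diff:
  fixes f g :: "'a \<Rightarrow> 'b::{real_normed_vector, second_countable_topology}"
  assumes "p \<ge> 1" "f \<in> Lp_space p M" "g \<in> Lp_space p M"
  shows "(\<lambda>x. f x - g x) \<in> Lp_space p M"
  using Lp_space_add[OF assms(1,2) Lp_space_scaleR[OF assms(3), of "-1"]] by simp

text \<open>The functional \<^const>\<open>Lp_integral\<close> is convex, hence so is its sublevel set, the unit ball.\<close>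

lemma Lp_seminorm_triangle:
  fixes f g :: "'a \<Rightarrow> 'b::{real_normed_vector, second_countable_topology}"
  assumes p: "p \<ge> 1" and f: "f \<in> Lp_space p M" and g: "g \<in> Lp_space p M"
  shows "Lp_seminorm p M (\<lambda>x. f x + g x) \<le> Lp_seminorm p M f + Lp_seminorm p M g"
proof (rule field_le_epsilon)
  fix e :: real assume "e > 0"
  define a b where "a = Lp_seminorm p M f + e / 2" and "b = Lp_seminorm p M g + e / 2"
  have ab: "a > 0" "b > 0"
    using \<open>e > 0\<close> by (simp_all add: a_def b_def Lp_seminorm_nonneg add_nonneg_pos)
  have unit: "Lp_integral p M (\<lambda>x. (1 / c) *\<^sub>R h x) \<le> 1"
    if "h \<in> Lp_space p M" "c > 0" "Lp_seminorm p M h \<le> c" for h :: "'a \<Rightarrow> 'b" and c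
    using Lp_integral_le_powr[OF _ Lp_space_scaleR[OF that(1)], of "1 / c" 1] that p
    by (simp add: Lp_seminorm_scaleR Lp_spaceD)
  define s where "s =
    (\<lambda>x. (a / (a + b)) *\<^sub>R ((1 / a) *\<^sub>R f x) + (b / (a + b)) *\<^sub>R ((1 / b) *\<^sub>R g x))"
  have s_measurable: "s \<in> borel_measurable M"
    unfolding s_def using Lp_spaceD(1)[OF f] Lp_spaceD(1)[OF g] by measurable
  have "Lp_integral p M s \<le> ennreal (a / (a + b)) * Lp_integral p M (\<lambda>x. (1 / a) *\<^sub>R f x)
      + ennreal (b / (a + b)) * Lp_integral p M (\<lambda>x. (1 / b) *\<^sub>R g x)"
    unfolding s_def using p ab f g
    by (intro Lp_integral_convex Lp_spaceD Lp_space_scaleR)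
      (auto simp: add_divide_distrib[symmetric])
  also have "\<dots> \<le> ennreal (a / (a + b)) * 1 + ennreal (b / (a + b)) * 1"
    using ab f g \<open>e > 0\<close> by (intro add_mono mult_left_mono unit) (auto simp: a_def b_def)
  also have "\<dots> = ennreal (1 powr p)"
    using ab by (simp add: ennreal_plus[symmetric] add_divide_distrib[symmetric] del: ennreal_plus)
  finally have "Lp_seminorm p M s \<le> 1"
    using p by (intro Lp_seminorm_le) auto
  then have "Lp_seminorm p M (\<lambda>x. (a + b) *\<^sub>R s x) \<le> a + b"
    using p ab s_measurable by (simp add: Lp_seminorm_scaleR)
  moreover have "(a + b) *\<^sub>R s x = f x + g x" for x
    using ab by (simp add: s_def scaleR_add_right)
  ultimately show "Lp_seminorm p M (\<lambda>x. f x + g x) \<le> Lp_seminorm p M f + Lp_seminorm p M g + e"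
    by (simp add: a_def b_def)
qed

lemma (in finite_measure) Lp_space_mono_exponent:
  assumes "0 \<le> p" "p \<le> p'" and f: "f \<in> Lp_space p' M"
  shows "f \<in> Lp_space p M"
proof -
  have pointwise: "ennreal (t powr p) \<le> 1 + ennreal (t powr p')" if "t \<ge> 0" for t
  proof -
    have "t powr p \<le> 1 + t powr p'"
      using assms(1,2) that powr_le1[of p t] powr_mono[of p p' t]
      by (cases "t \<le> 1") (auto intro: add_increasing2 add_increasing)
    then show ?thesis by (metis ennreal_1 ennreal_leI ennreal_plus powr_ge_zero zero_le_one)
  qed
  have "Lp_integral p M f \<le> (\<integral>\<^sup>+x. 1 + ennreal (norm (f x) powr p') \<partial>M)"
    unfolding Lp_integral_def by (intro nn_integral_mono pointwise norm_ge_zero)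
  also have "\<dots> = emeasure M (space M) + Lp_integral p' M f"
    using Lp_spaceD(1)[OF f] by (simp add: Lp_integral_def nn_integral_add)
  also have "\<dots> < \<infinity>" using Lp_spaceD(2)[OF f] by (simp add: less_top[symmetric])
  finally show ?thesis using f by (simp add: Lp_space_def)
qed

lemma Lp_restrict_space_mono:
  assumes "A \<subseteq> B" and sets: "A \<inter> space M \<in> sets M" "B \<inter> space M \<in> sets M"
    and p: "p > 0" and f: "f \<in> Lp_space p (restrict_space M B)"
  shows "f \<in> Lp_space p (restrict_space M A)"
    and "Lp_seminorm p (restrict_space M A) f \<le> Lp_seminorm p (restrict_space M B) f"
proof -
  have "Lp_integral p (restrict_space M A) f \<le> Lp_integral p (restrict_space M B) f"
    unfolding Lp_integral_def using \<open>A \<subseteq> B\<close>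
    by (auto simp: nn_integral_restrict_space[OF sets(1)] nn_integral_restrict_space[OF sets(2)]
        indicator_def intro!: nn_integral_mono)
  also have "\<dots> = ennreal (Lp_seminorm p (restrict_space M B) f powr p)"
    using p f by (rule Lp_integral_eq_seminorm_powr)
  finally have le: "Lp_integral p (restrict_space M A) f
      \<le> ennreal (Lp_seminorm p (restrict_space M B) f powr p)" .
  then show "Lp_seminorm p (restrict_space M A) f \<le> Lp_seminorm p (restrict_space M B) f"
    using p by (intro Lp_seminorm_le Lp_seminorm_nonneg)
  have "f \<in> borel_measurable (restrict_space M A)"
    using measurable_restrict_mono[OF Lp_spaceD(1)[OF f] \<open>A \<subseteq> B\<close>] .
  then show "f \<in> Lp_space p (restrict_space M A)"
    using le by (simp add: Lp_space_def le_less_trans)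
qed

lemma Youngs_inequality_scaled:
  fixes a x p :: real
  assumes "a > 0" "x \<ge> 0" "p \<ge> 1"
  shows "x \<le> (1 - 1 / p) * a + 1 / p * (a powr (1 - p) * x powr p)"
proof (cases "x = 0")
  case False
  have "a powr (1 - 1 / p) * (a powr (1 - p) * x powr p) powr (1 / p)
      = a powr (1 - 1 / p + (1 - p) / p) * x"
    using assms by (simp add: powr_mult powr_powr powr_add)
  also have "1 - 1 / p + (1 - p) / p = 0"
    using assms by (simp add: field_simps)
  finally show ?thesis
    using Youngs_inequality_0[of "1 - 1 / p" "1 / p" a "a powr (1 - p) * x powr p"] assms False
    by simp
qed (use assms in simp)

lemma nn_integral_norm_le_Lp_integral:
  assumes "a > 0" "p \<ge> 1" and [measurable]: "f \<in> borel_measurable M"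
  shows "(\<integral>\<^sup>+x. ennreal (norm (f x)) \<partial>M)
    \<le> ennreal ((1 - 1 / p) * a) * emeasure M (space M)
      + ennreal (1 / p * a powr (1 - p)) * Lp_integral p M f"
proof -
  have "(\<integral>\<^sup>+x. ennreal (norm (f x)) \<partial>M)
      \<le> (\<integral>\<^sup>+x. ennreal ((1 - 1 / p) * a)
            + ennreal (1 / p * a powr (1 - p)) * ennreal (norm (f x) powr p) \<partial>M)"
    using Youngs_inequality_scaled[OF assms(1) norm_ge_zero assms(2)] assms(1,2)
    by (intro nn_integral_mono)
      (simp add: ennreal_mult[symmetric] ennreal_plus[symmetric] ennreal_leI mult.assoc
        del: ennreal_plus)
  then show ?thesis
    by (simp add: nn_integral_add nn_integral_cmult Lp_integral_def)
qed

lemma (in finite_measure) nn_integral_norm_le_Lp_seminorm: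
  assumes p: "p \<ge> 1" and f: "f \<in> Lp_space p M" and V: "measure M (space M) > 0"
  shows "(\<integral>\<^sup>+x. ennreal (norm (f x)) \<partial>M)
    \<le> ennreal (measure M (space M) powr (1 - 1 / p) * Lp_seminorm p M f)"
proof (cases "Lp_seminorm p M f = 0")
  case True
  then have "(\<integral>\<^sup>+x. ennreal (norm (f x) powr p) \<partial>M) = 0"
    using Lp_integral_eq_seminorm_powr[OF _ f] p by (simp add: Lp_integral_def)
  then have "AE x in M. f x = 0"
    using Lp_spaceD(1)[OF f] by (simp add: nn_integral_0_iff_AE)
  then have "(\<integral>\<^sup>+x. ennreal (norm (f x)) \<partial>M) = (\<integral>\<^sup>+x. 0 \<partial>M)"
    by (intro nn_integral_cong_AE) auto
  then show ?thesis by simp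
next
  case False
  define V N where "V = measure M (space M)" and "N = Lp_seminorm p M f"
  define a where "a = N * V powr (- (1 / p))"
  have pos: "V > 0" "N > 0" "a > 0"
    using V False Lp_seminorm_nonneg[of p M f] by (simp_all add: V_def N_def a_def)
  have "(\<integral>\<^sup>+x. ennreal (norm (f x)) \<partial>M)
      \<le> ennreal ((1 - 1 / p) * a) * ennreal V
        + ennreal (1 / p * a powr (1 - p)) * ennreal (N powr p)"
    using nn_integral_norm_le_Lp_integral[OF pos(3) p Lp_spaceD(1)[OF f]]
      Lp_integral_eq_seminorm_powr[OF _ f] p
    by (simp add: N_def V_def emeasure_eq_measure)
  also have "\<dots> = ennreal ((1 - 1 / p) * (a * V) + 1 / p * (a powr (1 - p) * N powr p))"
    using p pos
    by (simp add: ennreal_mult[symmetric] ennreal_plus[symmetric] mult.assoc del: ennreal_plus)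
  also have "a * V = V powr (1 - 1 / p) * N"
    using pos by (simp add: a_def powr_diff powr_minus_divide)
  also have "a powr (1 - p) * N powr p = V powr (1 - 1 / p) * N"
  proof -
    have "- (1 / p) * (1 - p) = 1 - 1 / p" using p by (simp add: field_simps)
    then have "a powr (1 - p) = N powr (1 - p) * V powr (1 - 1 / p)"
      using pos by (simp only: a_def powr_mult powr_powr)
    moreover have "N powr (1 - p) * N powr p = N"
      using pos by (simp add: powr_add[symmetric])
    ultimately show ?thesis by (simp add: mult_ac)
  qed
  finally show ?thesis by (simp add: V_def N_def algebra_simps)
qed

lemma Lp_integral_Fatou:
  fixes f :: "nat \<Rightarrow> 'a \<Rightarrow> 'b::real_normed_vector"
  assumes [measurable]: "\<And>n. f n \<in> borel_measurable M"
    and "p > 0"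
    and lim: "\<And>x. x \<in> space M \<Longrightarrow> (\<lambda>n. f n x) \<longlonglongrightarrow> g x"
    and le: "\<forall>\<^sub>F n in sequentially. Lp_integral p M (f n) \<le> C"
  shows "Lp_integral p M g \<le> C"
proof -
  have "Lp_integral p M g = (\<integral>\<^sup>+x. liminf (\<lambda>n. ennreal (norm (f n x) powr p)) \<partial>M)"
    unfolding Lp_integral_def
  proof (rule nn_integral_cong)
    fix x assume "x \<in> space M"
    then have "(\<lambda>n. ennreal (norm (f n x) powr p)) \<longlonglongrightarrow> ennreal (norm (g x) powr p)"
      using \<open>p > 0\<close> by (auto intro!: tendsto_ennrealI tendsto_powr' tendsto_norm lim)
    then show "ennreal (norm (g x) powr p) = liminf (\<lambda>n. ennreal (norm (f n x) powr p))"
      by (metis lim_imp_Liminf trivial_limit_sequentially)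
  qed
  also have "\<dots> \<le> liminf (\<lambda>n. Lp_integral p M (f n))"
    unfolding Lp_integral_def by (rule nn_integral_liminf) measurable
  also have "\<dots> \<le> C" using le by (intro Liminf_le) auto
  finally show ?thesis .
qed

lemma Lp_diff_pointwise_limit:
  fixes f :: "nat \<Rightarrow> 'a \<Rightarrow> 'b::{real_normed_vector, second_countable_topology}"
  assumes p: "p \<ge> 1" and f: "\<And>n. f n \<in> Lp_space p M" and h: "h \<in> Lp_space p M" and "b \<ge> 0"
    and le: "\<forall>\<^sub>F n in sequentially. Lp_seminorm p M (\<lambda>x. h x - f n x) \<le> b"
    and lim: "\<And>x. x \<in> space M \<Longrightarrow> (\<lambda>n. f n x) \<longlonglongrightarrow> g x"
  shows "(\<lambda>x. h x - g x) \<in> Lp_space p M" "Lp_seminorm p M (\<lambda>x. h x - g x) \<le> b"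
proof -
  have "Lp_integral p M (\<lambda>x. h x - g x) \<le> ennreal (b powr p)"
  proof (rule Lp_integral_Fatou)
    show "(\<lambda>x. h x - f n x) \<in> borel_measurable M" for n
      using Lp_spaceD(1)[OF Lp_space_diff[OF p h f]] .
    show "(\<lambda>n. h x - f n x) \<longlonglongrightarrow> h x - g x" if "x \<in> space M" for x
      using lim[OF that] by (intro tendsto_intros)
    show "\<forall>\<^sub>F n in sequentially. Lp_integral p M (\<lambda>x. h x - f n x) \<le> ennreal (b powr p)"
      using le
    proof eventually_elim
      case (elim n)
      with p show ?case by (intro Lp_integral_le_powr Lp_space_diff p h f) auto
    qed
  qed (use p in simp)
  then show "Lp_seminorm p M (\<lambda>x. h x - g x) \<le> b" "(\<lambda>x. h x - g x) \<in> Lp_space p M"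
    using p \<open>b \<ge> 0\<close> Lp_spaceD(1)[OF h] borel_measurable_LIMSEQ_metric[OF Lp_spaceD(1)[OF f] lim]
    by (auto simp: Lp_space_def le_less_trans intro: Lp_seminorm_le)
qed

lemma Lp_Cauchy_pointwise_limit:
  fixes f :: "nat \<Rightarrow> 'a \<Rightarrow> 'b::{real_normed_vector, second_countable_topology}"
  assumes p: "p \<ge> 1" and f: "\<And>n. f n \<in> Lp_space p M"
    and Cauchy: "\<And>e. e > 0 \<Longrightarrow> \<exists>N. \<forall>n\<ge>N. \<forall>m\<ge>N. Lp_seminorm p M (\<lambda>x. f n x - f m x) < e"
    and lim: "\<And>x. x \<in> space M \<Longrightarrow> (\<lambda>n. f n x) \<longlonglongrightarrow> g x"
  shows "g \<in> Lp_space p M" "(\<lambda>n. Lp_seminorm p M (\<lambda>x. f n x - g x)) \<longlonglongrightarrow> 0"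
proof -
  have tail: "\<exists>N. \<forall>n\<ge>N. (\<lambda>x. f n x - g x) \<in> Lp_space p M \<and> Lp_seminorm p M (\<lambda>x. f n x - g x) \<le> e"
    if "e > 0" for e
  proof -
    obtain N where N: "\<And>n m. n \<ge> N \<Longrightarrow> m \<ge> N \<Longrightarrow> Lp_seminorm p M (\<lambda>x. f n x - f m x) < e"
      using Cauchy[OF \<open>e > 0\<close>] by blast
    have "\<forall>\<^sub>F m in sequentially. Lp_seminorm p M (\<lambda>x. f n x - f m x) \<le> e" if "n \<ge> N" for n
      unfolding eventually_sequentially using N[OF that] by (meson less_imp_le)
    then show ?thesis
      using Lp_diff_pointwise_limit[OF p f f _ _ lim] \<open>e > 0\<close> by (meson less_imp_le)
  qed
  obtain n where "(\<lambda>x. f n x - g x) \<in> Lp_space p M"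
    using tail[of 1] by auto
  then show "g \<in> Lp_space p M"
    using Lp_space_diff[OF p f[of n], of "\<lambda>x. f n x - g x"] by simp
  show "(\<lambda>n. Lp_seminorm p M (\<lambda>x. f n x - g x)) \<longlonglongrightarrow> 0"
  proof (rule LIMSEQ_I)
    fix e :: real assume "e > 0"
    then obtain N where N: "\<And>n. n \<ge> N \<Longrightarrow> Lp_seminorm p M (\<lambda>x. f n x - g x) \<le> e / 2"
      using tail[of "e / 2"] by auto
    have "norm (Lp_seminorm p M (\<lambda>x. f n x - g x) - 0) < e" if "n \<ge> N" for n
      using N[OF that] \<open>e > 0\<close> by (simp add: Lp_seminorm_nonneg)
    then show "\<exists>N. \<forall>n\<ge>N. norm (Lp_seminorm p M (\<lambda>x. f n x - g x) - 0) < e" by blast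
  qed
qed

lemma holo_on_le_Lp_seminorm:
  fixes f :: "complex ^ 'n \<Rightarrow> complex"
  assumes p: "p \<ge> 1" and holo: "holo_on (ball z r) f" and "r > 0"
    and sub: "ball z r \<subseteq> \<Omega>" and \<Omega>: "\<Omega> \<in> sets borel"
    and f: "f \<in> Lp_space p (restrict_space lborel \<Omega>)"
  shows "cmod (f z)
    \<le> measure lborel (ball z r) powr (- (1 / p)) * Lp_seminorm p (restrict_space lborel \<Omega>) f"
proof -
  let ?B = "restrict_space lborel (ball z r)"
  define V N where "V = measure lborel (ball z r)"
    and "N = Lp_seminorm p (restrict_space lborel \<Omega>) f"
  have "V > 0" using content_ball_pos[OF \<open>r > 0\<close>, of z] by (simp add: V_def)
  have emeasure_ball: "emeasure lborel (ball z r) = ennreal V"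
    unfolding V_def using emeasure_lborel_ball_finite[of z r]
    by (intro emeasure_eq_ennreal_measure) auto
  interpret finite_measure ?B
    by (intro finite_measureI) (simp add: emeasure_restrict_space emeasure_ball)
  have fB: "f \<in> Lp_space p ?B" "Lp_seminorm p ?B f \<le> N"
    unfolding N_def using Lp_restrict_space_mono[OF sub _ _ _ f] p \<Omega> by auto
  have "ennreal (cmod (f z) * V) \<le> (\<integral>\<^sup>+x\<in>ball z r. ennreal (cmod (f x)) \<partial>lborel)"
    using holo_on_sub_mean_value_ball[OF holo] \<open>V > 0\<close> by (simp add: emeasure_ball ennreal_mult)
  also have "\<dots> = (\<integral>\<^sup>+x. ennreal (cmod (f x)) \<partial>?B)"
    by (rule nn_integral_restrict_space[symmetric]) simp
  also have "\<dots> \<le> ennreal (V powr (1 - 1 / p) * Lp_seminorm p ?B f)"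
    using nn_integral_norm_le_Lp_seminorm[OF p fB(1)] \<open>V > 0\<close>
    by (simp add: measure_restrict_space V_def)
  also have "\<dots> \<le> ennreal (V powr (1 - 1 / p) * N)"
    using fB(2) by (intro ennreal_leI mult_left_mono) auto
  finally have "cmod (f z) * V \<le> V powr (1 - 1 / p) * N"
    by (simp add: N_def Lp_seminorm_nonneg)
  also have "V powr (1 - 1 / p) = V powr (- (1 / p)) * V"
    using \<open>V > 0\<close> by (simp add: powr_diff powr_minus_divide)
  finally show ?thesis
    using \<open>V > 0\<close> by (simp add: V_def N_def mult.assoc mult.left_commute)
qed

section \<open>The metric space\<close>

lemma divide_one_plus_mono: "0 \<le> x \<Longrightarrow> x \<le> y \<Longrightarrow> x / (1 + x) \<le> y / (1 + y)" for x y :: real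
  by (simp add: field_simps)

lemma divide_one_plus_subadditive:
  fixes x y z :: real
  assumes "0 \<le> x" "0 \<le> y" "0 \<le> z" "z \<le> x + y"
  shows "z / (1 + z) \<le> x / (1 + x) + y / (1 + y)"
proof -
  have "z / (1 + z) \<le> (x + y) / (1 + (x + y))" using assms by (intro divide_one_plus_mono) auto
  also have "\<dots> = x / (1 + (x + y)) + y / (1 + (x + y))" by (simp add: add_divide_distrib)
  also have "\<dots> \<le> x / (1 + x) + y / (1 + y)"
    using assms by (intro add_mono divide_left_mono mult_pos_pos) auto
  finally show ?thesis .
qed

definition frechet_sum :: "(nat \<Rightarrow> real) \<Rightarrow> real" where
  "frechet_sum x = (\<Sum>j. (1/2) ^ Suc j * (x j / (1 + x j)))"

lemma frechet_sum_term_nonneg: "0 \<le> t \<Longrightarrow> 0 \<le> (1/2) ^ k * (t / (1 + t))" for t :: real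
  by simp

lemma frechet_sum_term_norm_le:
  fixes t :: real
  assumes "0 \<le> t"
  shows "norm ((1/2) ^ k * (t / (1 + t))) \<le> (1/2) ^ k"
proof -
  have "(1/2) ^ k * (t / (1 + t)) \<le> (1/2) ^ k * 1"
    using assms by (intro mult_left_mono) auto
  then show ?thesis
    unfolding real_norm_def abs_of_nonneg[OF frechet_sum_term_nonneg[OF assms]] by simp
qed

lemma frechet_sum_summable:
  fixes x :: "nat \<Rightarrow> real"
  assumes "\<And>j. 0 \<le> x j"
  shows "summable (\<lambda>j. (1/2) ^ Suc j * (x j / (1 + x j)))"
proof (rule summable_comparison_test')
  show "summable (\<lambda>j. (1/2 :: real) ^ Suc j)" by (simp add: summable_geometric)
  show "norm ((1/2) ^ Suc j * (x j / (1 + x j))) \<le> (1/2) ^ Suc j" for j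
    by (rule frechet_sum_term_norm_le[OF assms])
qed

lemma frechet_sum_nonneg:
  assumes "\<And>j. 0 \<le> x j"
  shows "0 \<le> frechet_sum x"
  unfolding frechet_sum_def
  by (intro suminf_nonneg frechet_sum_summable frechet_sum_term_nonneg assms)

lemma frechet_sum_zero: "frechet_sum (\<lambda>j. 0) = 0"
  by (simp add: frechet_sum_def)

lemma frechet_sum_subadditive:
  assumes "\<And>j. 0 \<le> x j" "\<And>j. 0 \<le> y j" "\<And>j. 0 \<le> z j" "\<And>j. z j \<le> x j + y j"
  shows "frechet_sum z \<le> frechet_sum x + frechet_sum y"
  unfolding frechet_sum_def
    suminf_add[OF frechet_sum_summable[of x, OF assms(1)] frechet_sum_summable[of y, OF assms(2)]]
proof (intro suminf_le summable_add frechet_sum_summable assms)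
  fix j
  have "(1/2) ^ Suc j * (z j / (1 + z j)) \<le> (1/2) ^ Suc j * (x j / (1 + x j) + y j / (1 + y j))"
    using assms by (intro mult_left_mono divide_one_plus_subadditive) auto
  then show "(1/2) ^ Suc j * (z j / (1 + z j))
      \<le> (1/2) ^ Suc j * (x j / (1 + x j)) + (1/2) ^ Suc j * (y j / (1 + y j))"
    by (simp only: distrib_left)
qed

lemma frechet_sum_less_imp_component_less:
  assumes "\<And>j. 0 \<le> x j" "e > 0" "frechet_sum x < (1/2) ^ Suc j * (e / (1 + e))"
  shows "x j < e"
proof -
  have "(\<Sum>i\<in>{j}. (1/2) ^ Suc i * (x i / (1 + x i))) \<le> frechet_sum x"
    unfolding frechet_sum_def
    by (intro sum_le_suminf frechet_sum_summable frechet_sum_term_nonneg assms(1)) auto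
  with assms(3) have "(1/2) ^ Suc j * (x j / (1 + x j)) < (1/2) ^ Suc j * (e / (1 + e))"
    by simp
  then have "x j / (1 + x j) < e / (1 + e)"
    by (simp only: mult_less_cancel_left_pos zero_less_power half_gt_zero_iff zero_less_one)
  then show ?thesis
    using divide_one_plus_mono[of e "x j"] assms(2) by linarith
qed

lemma frechet_sum_tendsto_0:
  assumes nonneg: "\<And>n j. 0 \<le> x n j" and lim: "\<And>j. (\<lambda>n. x n j) \<longlonglongrightarrow> 0"
  shows "(\<lambda>n. frechet_sum (x n)) \<longlonglongrightarrow> 0"
proof -
  have "(\<lambda>n. \<Sum>j. (1/2) ^ Suc j * (x n j / (1 + x n j))) \<longlonglongrightarrow> (\<Sum>j. 0)"
  proof (rule tannerys_theorem[THEN conjunct2, THEN conjunct2])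
    show "(\<lambda>n. (1/2) ^ Suc j * (x n j / (1 + x n j))) \<longlonglongrightarrow> 0" for j
      by (rule tendsto_eq_intros refl lim | simp)+
    show "\<forall>\<^sub>F (j, n) in sequentially \<times>\<^sub>F sequentially.
        norm ((1/2) ^ Suc j * (x n j / (1 + x n j))) \<le> (1/2) ^ Suc j"
      by (intro always_eventually) (clarify, rule frechet_sum_term_norm_le[OF nonneg])
    show "summable (\<lambda>j. (1/2 :: real) ^ Suc j)" by (simp add: summable_geometric)
  qed simp
  then show ?thesis by (simp add: frechet_sum_def)
qed

locale OL_space =
  fixes \<Omega> :: "(complex ^ 'n) set" and q :: ereal and ps :: "nat \<Rightarrow> real"
  assumes bounded_dom: "bounded \<Omega>" and open_dom: "open \<Omega>" and adm: "admissible_seq q ps"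
begin

abbreviation "X \<equiv> OLq q \<Omega>"
abbreviation "vol \<equiv> restrict_space lborel \<Omega>"

lemma dom_borel: "\<Omega> \<in> sets borel"
  using open_dom by simp

sublocale vol: finite_measure vol
proof (rule finite_measureI)
  show "emeasure vol (space vol) \<noteq> \<infinity>"
    using emeasure_bounded_finite[OF bounded_dom] dom_borel by (simp add: emeasure_restrict_space)
qed

lemma ps_gt_1: "1 < ps j"
proof -
  have "ps 0 \<le> ps j" using adm by (simp add: admissible_seq_def strict_mono_less_eq)
  then show ?thesis using adm by (simp add: admissible_seq_def)
qed

lemma ps_ge_1: "1 \<le> ps j" and ps_pos: "0 < ps j"
  using ps_gt_1[of j] by auto

lemma set_nn_integral_eq_Lp_integral:
  "(\<integral>\<^sup>+x\<in>\<Omega>. ennreal (cmod (f x) powr p) \<partial>lborel) = Lp_integral p vol f"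
  unfolding Lp_integral_def using dom_borel by (intro nn_integral_restrict_space[symmetric]) simp

lemma OLdist_eq: "OLdist ps \<Omega> f g = frechet_sum (\<lambda>j. Lp_seminorm (ps j) vol (\<lambda>z. f z - g z))"
  by (simp add: OLdist_def frechet_sum_def Lp_norm_def Lp_seminorm_def
      set_nn_integral_eq_Lp_integral)

lemma borel_measurable_holo_on: "holo_on \<Omega> f \<Longrightarrow> f \<in> borel_measurable vol"
  using borel_measurable_continuous_on_restrict[OF holo_on_imp_continuous_on]
  by (subst measurable_cong_sets[OF sets_restrict_space_cong[OF sets_lborel] refl])

lemma OLq_iff:
  "f \<in> X \<longleftrightarrow> holo_on \<Omega> f \<and> (\<forall>x. x \<notin> \<Omega> \<longrightarrow> f x = 0) \<and> (\<forall>j. f \<in> Lp_space (ps j) vol)"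
proof -
  have "f \<in> Lp_space p vol" if "\<forall>j. f \<in> Lp_space (ps j) vol" "1 \<le> p" "ereal p < q" for p
  proof -
    have "\<forall>\<^sub>F j in sequentially. ereal p < ereal (ps j)"
      using adm that(3) by (auto simp: admissible_seq_def dest: order_tendstoD(1))
    then obtain j where "ereal p < ereal (ps j)"
      using eventually_happens'[OF sequentially_bot] by blast
    then show ?thesis using vol.Lp_space_mono_exponent[of p "ps j" f] that by simp
  qed
  then show ?thesis
    using adm ps_ge_1 unfolding OLq_def set_nn_integral_eq_Lp_integral admissible_seq_def
    by (auto simp: Lp_space_def borel_measurable_holo_on)
qed

lemma OLq_holo_on: "f \<in> X \<Longrightarrow> holo_on \<Omega> f"
  and OLq_Lp_space: "f \<in> X \<Longrightarrow> f \<in> Lp_space (ps j) vol"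
  by (simp_all add: OLq_iff)

lemma OLq_add: "f \<in> X \<Longrightarrow> g \<in> X \<Longrightarrow> (\<lambda>z. f z + g z) \<in> X"
  by (simp add: OLq_iff holo_on_add Lp_space_add ps_ge_1)

lemma OLq_scaleR: "f \<in> X \<Longrightarrow> (\<lambda>z. a *\<^sub>R f z) \<in> X"
  by (simp add: OLq_iff holo_on_scaleR Lp_space_scaleR)

lemma OLq_diff: "f \<in> X \<Longrightarrow> g \<in> X \<Longrightarrow> (\<lambda>z. f z - g z) \<in> X"
  by (simp add: OLq_iff holo_on_diff Lp_space_diff ps_ge_1)

lemma OLq_locally_bounded_by_seminorm:
  assumes "z \<in> \<Omega>"
  obtains r K where "r > 0" "K > 0" "cball z r \<subseteq> \<Omega>"
    "\<And>f w. f \<in> X \<Longrightarrow> w \<in> cball z r \<Longrightarrow> cmod (f w) \<le> K * Lp_seminorm (ps 0) vol f"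
proof -
  obtain s where s: "s > 0" "cball z s \<subseteq> \<Omega>"
    using open_dom assms open_contains_cball by blast
  define r K where "r = s / 2" and "K = measure lborel (ball z r) powr (- (1 / ps 0))"
  show ?thesis
  proof
    show "r > 0" using s by (simp add: r_def)
    then show "K > 0" by (simp add: K_def content_ball_pos)
    show "cball z r \<subseteq> \<Omega>" using s by (auto simp: r_def)
    fix f w assume f: "f \<in> X" and w: "w \<in> cball z r"
    have sub: "ball w r \<subseteq> \<Omega>"
      using cball_half_subset[of w z s] w s(2) ball_subset_cball[of w r] unfolding r_def by blast
    have "cmod (f w) \<le> measure lborel (ball w r) powr (- (1 / ps 0)) * Lp_seminorm (ps 0) vol f"
      using ps_ge_1 holo_on_subset[OF OLq_holo_on[OF f] sub] \<open>r > 0\<close> sub dom_borel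
        OLq_Lp_space[OF f]
      by (rule holo_on_le_Lp_seminorm)
    also have "measure lborel (ball w r) = measure lborel (ball z r)"
      using \<open>r > 0\<close> by (simp add: content_ball)
    finally show "cmod (f w) \<le> K * Lp_seminorm (ps 0) vol f" by (simp add: K_def)
  qed
qed

lemma OLdist_less_imp_seminorm_less:
  assumes "e > 0"
  obtains \<delta> where "\<delta> > 0"
    "\<And>f g. OLdist ps \<Omega> f g < \<delta> \<Longrightarrow> Lp_seminorm (ps j) vol (\<lambda>z. f z - g z) < e"
proof
  show "(1/2) ^ Suc j * (e / (1 + e)) > 0" using assms by simp
  show "Lp_seminorm (ps j) vol (\<lambda>z. f z - g z) < e"
    if "OLdist ps \<Omega> f g < (1/2) ^ Suc j * (e / (1 + e))" for f g
    using frechet_sum_less_imp_component_less[OF Lp_seminorm_nonneg assms] that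
    unfolding OLdist_eq .
qed

lemma OLdist_zero_iff:
  assumes "f \<in> X" "g \<in> X"
  shows "OLdist ps \<Omega> f g = 0 \<longleftrightarrow> f = g"
proof
  assume zero: "OLdist ps \<Omega> f g = 0"
  have seminorm_zero: "Lp_seminorm (ps 0) vol (\<lambda>z. f z - g z) = 0"
  proof (rule antisym[OF dense_ge Lp_seminorm_nonneg])
    fix e :: real assume "e > 0"
    then show "Lp_seminorm (ps 0) vol (\<lambda>z. f z - g z) \<le> e"
      using OLdist_less_imp_seminorm_less[of e 0] zero by (metis less_imp_le)
  qed
  have "f z = g z" for z
  proof (cases "z \<in> \<Omega>")
    case True
    then obtain r K where "r > 0"
      "\<And>f w. f \<in> X \<Longrightarrow> w \<in> cball z r \<Longrightarrow> cmod (f w) \<le> K * Lp_seminorm (ps 0) vol f"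
      using OLq_locally_bounded_by_seminorm by metis
    from this(2)[OF OLq_diff[OF assms], of z] this(1) show ?thesis
      by (simp add: seminorm_zero)
  qed (use assms in \<open>simp add: OLq_iff\<close>)
  then show "f = g" by blast
qed (simp add: OLdist_eq Lp_seminorm_zero frechet_sum_zero)

sublocale M: Metric_space X "OLdist ps \<Omega>"
proof
  fix f g h
  show "0 \<le> OLdist ps \<Omega> f g"
    unfolding OLdist_eq by (intro frechet_sum_nonneg Lp_seminorm_nonneg)
  show "OLdist ps \<Omega> f g = OLdist ps \<Omega> g f"
    unfolding OLdist_eq by (simp add: Lp_seminorm_minus_commute[of _ _ f g])
  show "OLdist ps \<Omega> f g = 0 \<longleftrightarrow> f = g" if "f \<in> X" "g \<in> X"
    using that by (rule OLdist_zero_iff)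
  show "OLdist ps \<Omega> f h \<le> OLdist ps \<Omega> f g + OLdist ps \<Omega> g h" if "f \<in> X" "g \<in> X" "h \<in> X"
    unfolding OLdist_eq
  proof (intro frechet_sum_subadditive Lp_seminorm_nonneg)
    fix j
    show "Lp_seminorm (ps j) vol (\<lambda>z. f z - h z)
        \<le> Lp_seminorm (ps j) vol (\<lambda>z. f z - g z) + Lp_seminorm (ps j) vol (\<lambda>z. g z - h z)"
      using Lp_seminorm_triangle[of "ps j" "\<lambda>z. f z - g z" vol "\<lambda>z. g z - h z"] that
      by (simp add: ps_ge_1 OLq_Lp_space OLq_diff)
  qed
qed

lemma limitin_if_seminorms_tendsto_0:
  assumes "g \<in> X" "\<And>n. f n \<in> X"
    and "\<And>j. (\<lambda>n. Lp_seminorm (ps j) vol (\<lambda>z. f n z - g z)) \<longlonglongrightarrow> 0"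
  shows "limitin M.mtopology f g sequentially"
  unfolding M.limitin_metric_dist_null OLdist_eq using assms
  by (auto intro: frechet_sum_tendsto_0 Lp_seminorm_nonneg)

lemma MCauchy_seminorm:
  assumes "M.MCauchy f" "e > 0"
  shows "\<exists>N. \<forall>n\<ge>N. \<forall>m\<ge>N. Lp_seminorm (ps j) vol (\<lambda>z. f n z - f m z) < e"
proof -
  obtain \<delta> where "\<delta> > 0" "\<And>f g. OLdist ps \<Omega> f g < \<delta> \<Longrightarrow> Lp_seminorm (ps j) vol (\<lambda>z. f z - g z) < e"
    using OLdist_less_imp_seminorm_less[OF \<open>e > 0\<close>] by blast
  then show ?thesis using assms(1) unfolding M.MCauchy_def by meson
qed

lemma MCauchy_uniform_limit:
  assumes Cauchy: "M.MCauchy f" and z: "z \<in> \<Omega>"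
  shows "\<exists>r>0. cball z r \<subseteq> \<Omega> \<and> uniform_limit (cball z r) f (\<lambda>z. lim (\<lambda>n. f n z)) sequentially"
proof -
  have f: "f n \<in> X" for n using Cauchy by (auto simp: M.MCauchy_def)
  obtain r K where r: "r > 0" "K > 0" "cball z r \<subseteq> \<Omega>"
    and bound: "\<And>f w. f \<in> X \<Longrightarrow> w \<in> cball z r \<Longrightarrow> cmod (f w) \<le> K * Lp_seminorm (ps 0) vol f"
    using OLq_locally_bounded_by_seminorm[OF z] by metis
  have "uniformly_Cauchy_on (cball z r) f"
    unfolding uniformly_Cauchy_on_def
  proof (intro allI impI)
    fix e :: real assume "e > 0"
    then obtain N where N:
      "\<And>n m. n \<ge> N \<Longrightarrow> m \<ge> N \<Longrightarrow> Lp_seminorm (ps 0) vol (\<lambda>z. f n z - f m z) < e / K"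
      using MCauchy_seminorm[OF Cauchy, of "e / K" 0] \<open>K > 0\<close> by auto
    have "dist (f m w) (f n w) < e" if "w \<in> cball z r" "m \<ge> N" "n \<ge> N" for w m n
    proof -
      have "cmod (f m w - f n w) \<le> K * Lp_seminorm (ps 0) vol (\<lambda>z. f m z - f n z)"
        using OLq_diff[OF f f] that(1) by (rule bound)
      also have "\<dots> < K * (e / K)" using N that \<open>K > 0\<close> by (intro mult_strict_left_mono)
      finally show ?thesis using \<open>K > 0\<close> by (simp add: dist_norm)
    qed
    then show "\<exists>N. \<forall>w\<in>cball z r. \<forall>m\<ge>N. \<forall>n\<ge>N. dist (f m w) (f n w) < e" by blast
  qed
  then have "uniform_limit (cball z r) f (\<lambda>z. lim (\<lambda>n. f n z)) sequentially"
    unfolding uniformly_convergent_uniform_limit_iff[symmetric]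
    by (rule Cauchy_uniformly_convergent)
  then show ?thesis using r by blast
qed

lemma mcomplete: "M.mcomplete"
  unfolding M.mcomplete_def
proof (intro allI impI)
  fix f assume Cauchy: "M.MCauchy f"
  then have f: "f n \<in> X" for n by (auto simp: M.MCauchy_def)
  define g where "g = (\<lambda>z. lim (\<lambda>n. f n z))"
  have unif: "\<exists>r>0. cball z r \<subseteq> \<Omega> \<and> uniform_limit (cball z r) f g sequentially" if "z \<in> \<Omega>" for z
    using MCauchy_uniform_limit[OF Cauchy that] by (simp add: g_def)
  have lim: "(\<lambda>n. f n z) \<longlonglongrightarrow> g z" if "z \<in> space vol" for z
    using unif[of z] that by (auto simp: space_restrict_space intro: tendsto_uniform_limitI)
  note Lp_limit =
    Lp_Cauchy_pointwise_limit[OF ps_ge_1 OLq_Lp_space[OF f] MCauchy_seminorm[OF Cauchy] lim]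
  have "holo_on \<Omega> g"
    using OLq_holo_on[OF f] unif by (rule holo_on_uniform_sequence)
  moreover have "g z = 0" if "z \<notin> \<Omega>" for z
    using f that by (simp add: g_def OLq_iff)
  ultimately have "g \<in> X" using Lp_limit(1) by (simp add: OLq_iff)
  then have "limitin M.mtopology f g sequentially"
    using f Lp_limit(2) by (rule limitin_if_seminorms_tendsto_0)
  then show "\<exists>g. limitin M.mtopology f g sequentially" by blast
qed

lemma continuous_map_evaluation:
  assumes "z \<in> \<Omega>"
  shows "continuous_map M.mtopology euclidean (\<lambda>f. f z)"
  unfolding M.continuous_map_from_metric
proof (intro conjI ballI allI impI)
  fix f U assume f: "f \<in> X" and "openin euclidean U \<and> f z \<in> U"
  then obtain e where e: "e > 0" "ball (f z) e \<subseteq> U" by (auto elim: openE)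
  obtain r K where "r > 0" "K > 0"
    and bound: "\<And>f w. f \<in> X \<Longrightarrow> w \<in> cball z r \<Longrightarrow> cmod (f w) \<le> K * Lp_seminorm (ps 0) vol f"
    using OLq_locally_bounded_by_seminorm[OF assms] by metis
  then obtain \<delta> where \<delta>: "\<delta> > 0"
    "\<And>f g. OLdist ps \<Omega> f g < \<delta> \<Longrightarrow> Lp_seminorm (ps 0) vol (\<lambda>z. f z - g z) < e / K"
    using OLdist_less_imp_seminorm_less[of "e / K"] e by (metis divide_pos_pos)
  have "g z \<in> U" if "g \<in> X" "OLdist ps \<Omega> f g < \<delta>" for g
  proof -
    have "cmod (f z - g z) \<le> K * Lp_seminorm (ps 0) vol (\<lambda>z. f z - g z)"
      using bound[OF OLq_diff[OF f that(1)], of z] \<open>r > 0\<close> by simp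
    also have "\<dots> < K * (e / K)" using \<delta>(2)[OF that(2)] \<open>K > 0\<close> by (rule mult_strict_left_mono)
    finally show ?thesis using \<open>K > 0\<close> e(2) by (auto simp: dist_norm)
  qed
  then show "\<exists>\<delta>>0. \<forall>g. g \<in> X \<and> OLdist ps \<Omega> f g < \<delta> \<longrightarrow> g z \<in> U"
    using \<delta>(1) by blast
qed simp

lemma limitin_imp_LIMSEQ:
  assumes "limitin M.mtopology f g sequentially" "z \<in> \<Omega>"
  shows "(\<lambda>n. f n z) \<longlonglongrightarrow> g z"
  using continuous_map_limit[OF continuous_map_evaluation[OF assms(2)] assms(1)]
  by (simp add: o_def)

end

section \<open>Components near the boundary\<close>

lemma component_subset_component:
  assumes "E \<in> components A" "B \<subseteq> A" "y \<in> E" "y \<in> B"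
  obtains E' where "E' \<in> components B" "E' \<subseteq> E"
proof
  let ?E' = "connected_component_set B y"
  show "?E' \<in> components B" using \<open>y \<in> B\<close> by (rule componentsI)
  show "?E' \<subseteq> E"
  proof (rule components_maximal[OF \<open>E \<in> components A\<close>])
    show "?E' \<subseteq> A" using connected_component_subset \<open>B \<subseteq> A\<close> by blast
    show "E \<inter> ?E' \<noteq> {}" using \<open>y \<in> E\<close> \<open>y \<in> B\<close> connected_component_refl[of y B] by blast
  qed simp
qed

lemma countable_components:
  fixes S :: "'a::{real_normed_vector, second_countable_topology} set"
  assumes "open S"
  shows "countable (components S)"
  using open_components[OF assms] pairwise_disjoint_components[of S]
  by (intro countable_disjoint_open_subsets) (auto simp: pairwise_def disjnt_def)

lemma component_accumulates_at_frontier: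
  fixes U \<Omega> :: "'a::real_normed_vector set"
  assumes "open U" "connected U" "open \<Omega>" "\<not> U \<subseteq> \<Omega>" and E: "E \<in> components (U \<inter> \<Omega>)"
  obtains \<zeta> where "\<zeta> \<in> U" "\<zeta> \<in> frontier \<Omega>" "\<zeta> \<in> closure E"
proof -
  have sub: "E \<subseteq> U \<inter> \<Omega>" and "E \<noteq> {}" and "connected E"
    using E by (auto dest: in_components_subset in_components_nonempty in_components_connected)
  have "open E" using open_components[OF open_Int[OF assms(1,3)] E] .
  have "U \<inter> frontier E \<noteq> {}"
    using assms sub \<open>E \<noteq> {}\<close> by (intro connected_Int_frontier) auto
  then obtain \<zeta> where \<zeta>: "\<zeta> \<in> U" "\<zeta> \<in> closure E" "\<zeta> \<notin> E"
    using \<open>open E\<close> by (auto simp: frontier_def interior_open)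
  have "\<zeta> \<notin> \<Omega>"
  proof
    assume "\<zeta> \<in> \<Omega>"
    have "insert \<zeta> E \<subseteq> closure E" using \<zeta>(2) closure_subset by blast
    then have "connected (insert \<zeta> E)"
      by (rule connected_intermediate_closure[OF \<open>connected E\<close> subset_insertI])
    then have "insert \<zeta> E \<subseteq> E"
      by (rule components_maximal[OF E]) (use \<zeta>(1) \<open>\<zeta> \<in> \<Omega>\<close> sub \<open>E \<noteq> {}\<close> in auto)
    then show False using \<zeta>(3) by blast
  qed
  moreover have "\<zeta> \<in> closure \<Omega>" using \<zeta>(2) sub closure_mono[of E \<Omega>] by blast
  ultimately have "\<zeta> \<in> frontier \<Omega>" using \<open>open \<Omega>\<close> by (simp add: frontier_def interior_open)
  then show ?thesis using that \<zeta> by blast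
qed

definition boundary_pieces :: "'a::metric_space set \<Rightarrow> 'a set \<Rightarrow> ('a \<times> real \<times> 'a set) set" where
  "boundary_pieces D \<Omega> = {(c, r, E). c \<in> D \<and> r \<in> \<rat> \<and> r > 0 \<and> \<not> ball c r \<subseteq> \<Omega>
     \<and> E \<in> components (ball c r \<inter> \<Omega>)}"

lemma boundary_piecesD:
  assumes "(c, r, E) \<in> boundary_pieces D \<Omega>"
  shows "r > 0" "\<not> ball c r \<subseteq> \<Omega>" "E \<in> components (ball c r \<inter> \<Omega>)"
    "E \<subseteq> ball c r" "E \<subseteq> \<Omega>"
  using assms in_components_subset by (auto simp: boundary_pieces_def)

lemma countable_boundary_pieces:
  fixes \<Omega> :: "'a::{real_normed_vector, second_countable_topology} set"
  assumes "countable D" "open \<Omega>"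
  shows "countable (boundary_pieces D \<Omega>)"
proof (rule countable_subset)
  show "boundary_pieces D \<Omega> \<subseteq> (SIGMA c:D. SIGMA r:\<rat>. components (ball c r \<inter> \<Omega>))"
    by (auto simp: boundary_pieces_def)
  show "countable (SIGMA c:D. SIGMA r:\<rat>. components (ball c r \<inter> \<Omega>))"
    using assms by (intro countable_SIGMA countable_rat countable_components open_Int open_ball)
qed

lemma boundary_piece_accumulates_at_frontier:
  fixes \<Omega> :: "'a::real_normed_vector set"
  assumes "open \<Omega>" "(c, r, E) \<in> boundary_pieces D \<Omega>"
  obtains \<zeta> where "\<zeta> \<in> ball c r" "\<zeta> \<in> frontier \<Omega>" "\<zeta> \<in> closure E"
  using component_accumulates_at_frontier[OF open_ball connected_ball assms(1)]
    boundary_piecesD[OF assms(2)] by metis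

lemma boundary_piece_subset_component:
  assumes "closure D = UNIV" "open \<Omega>"
    and E: "E \<in> components (U \<inter> \<Omega>)" and \<zeta>: "\<zeta> \<in> closure E" "\<zeta> \<in> frontier \<Omega>"
    and W: "open W" "\<zeta> \<in> W" "W \<subseteq> U"
  obtains c r E' where "(c, r, E') \<in> boundary_pieces D \<Omega>" "cball c r \<subseteq> W" "E' \<subseteq> E"
proof -
  obtain e where e: "e > 0" "ball \<zeta> e \<subseteq> W" using W openE by blast
  obtain r where r: "r \<in> \<rat>" "e / 4 < r" "r < e / 2"
    using Rats_dense_in_real[of "e / 4" "e / 2"] e by auto
  obtain c where c: "c \<in> D" "dist c \<zeta> < e / 4"
    using \<open>closure D = UNIV\<close> e(1)
    by (metis UNIV_I closure_approachable zero_less_divide_iff zero_less_numeral)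
  have "cball c r \<subseteq> ball \<zeta> e"
  proof
    fix x assume "x \<in> cball c r"
    then show "x \<in> ball \<zeta> e"
      using dist_triangle[of \<zeta> x c] c(2) r e(1) by (simp add: dist_commute)
  qed
  then have cball: "cball c r \<subseteq> W" using e(2) by blast
  have "\<zeta> \<in> ball c r" using c r by simp
  then obtain y where y: "y \<in> E" "y \<in> ball c r"
    using \<zeta>(1) by (meson closure_iff_nhds_not_empty disjoint_iff open_ball order_refl)
  have "ball c r \<inter> \<Omega> \<subseteq> U \<inter> \<Omega>" using cball W(3) ball_subset_cball[of c r] by blast
  moreover have "y \<in> ball c r \<inter> \<Omega>" using y in_components_subset[OF E] by blast
  ultimately obtain E' where E': "E' \<in> components (ball c r \<inter> \<Omega>)" "E' \<subseteq> E"
    using component_subset_component[OF E _ y(1)] by metis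
  have "\<zeta> \<notin> \<Omega>" using \<zeta>(2) \<open>open \<Omega>\<close> frontier_disjoint_eq by blast
  then have "\<not> ball c r \<subseteq> \<Omega>" using \<open>\<zeta> \<in> ball c r\<close> by blast
  then have "(c, r, E') \<in> boundary_pieces D \<Omega>"
    using c(1) r e(1) E'(1) by (simp add: boundary_pieces_def)
  then show ?thesis using cball E'(2) by (rule that)
qed

lemma SUP_norm_eq_infinity_iff:
  "(SUP z\<in>E. ereal (norm (f z))) = \<infinity> \<longleftrightarrow> \<not> bounded (f ` E)"
proof
  assume sup: "(SUP z\<in>E. ereal (norm (f z))) = \<infinity>"
  show "\<not> bounded (f ` E)"
  proof
    assume "bounded (f ` E)"
    then obtain B where "\<And>z. z \<in> E \<Longrightarrow> norm (f z) \<le> B" by (auto simp: bounded_iff)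
    then have "(SUP z\<in>E. ereal (norm (f z))) \<le> ereal B" by (intro SUP_least) auto
    then show False using sup by simp
  qed
next
  assume unbounded: "\<not> bounded (f ` E)"
  show "(SUP z\<in>E. ereal (norm (f z))) = \<infinity>"
  proof (rule SUP_PInfty)
    fix n :: nat
    obtain z where "z \<in> E" "real n < norm (f z)"
      using unbounded by (auto simp: bounded_iff not_le)
    then show "\<exists>z\<in>E. ereal (real n) \<le> ereal (norm (f z))"
      by (intro bexI[of _ z]) auto
  qed
qed

lemma totally_unbounded_iff:
  fixes \<Omega> :: "(complex ^ 'n) set"
  assumes "closure D = UNIV" "open \<Omega>"
  shows "totally_unbounded \<Omega> f \<longleftrightarrow> (\<forall>(c, r, E)\<in>boundary_pieces D \<Omega>. \<not> bounded (f ` E))"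
proof
  assume unbounded: "totally_unbounded \<Omega> f"
  have "\<not> bounded (f ` E)" if piece: "(c, r, E) \<in> boundary_pieces D \<Omega>" for c r E
  proof -
    obtain \<zeta> where \<zeta>: "\<zeta> \<in> ball c r" "\<zeta> \<in> frontier \<Omega>" "\<zeta> \<in> closure E"
      using boundary_piece_accumulates_at_frontier[OF \<open>open \<Omega>\<close> piece] .
    obtain \<delta> where \<delta>: "\<delta> > 0" "ball \<zeta> \<delta> \<subseteq> ball c r" using openE[OF open_ball \<zeta>(1)] .
    obtain x where x: "x \<in> E" "x \<in> ball \<zeta> \<delta>"
      using \<zeta>(3) \<delta>(1) by (auto simp: closure_approachable dist_commute)
    have "ball \<zeta> \<delta> \<inter> \<Omega> \<subseteq> ball c r \<inter> \<Omega>" "x \<in> ball \<zeta> \<delta> \<inter> \<Omega>"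
      using \<delta>(2) x boundary_piecesD(5)[OF piece] by auto
    then obtain E' where E': "E' \<in> components (ball \<zeta> \<delta> \<inter> \<Omega>)" "E' \<subseteq> E"
      using component_subset_component[OF boundary_piecesD(3)[OF piece] _ x(1)] by metis
    then have "\<not> bounded (f ` E')"
      using unbounded \<zeta>(2) \<delta>(1) unfolding totally_unbounded_def SUP_norm_eq_infinity_iff by blast
    then show ?thesis using bounded_subset[OF _ image_mono[OF E'(2)]] by blast
  qed
  then show "\<forall>(c, r, E)\<in>boundary_pieces D \<Omega>. \<not> bounded (f ` E)" by blast
next
  assume unbounded: "\<forall>(c, r, E)\<in>boundary_pieces D \<Omega>. \<not> bounded (f ` E)"
  show "totally_unbounded \<Omega> f"
    unfolding totally_unbounded_def SUP_norm_eq_infinity_iff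
  proof (intro ballI allI impI)
    fix w \<delta> E
    assume w: "w \<in> frontier \<Omega>" and \<delta>: "0 < (\<delta>::real)" and E: "E \<in> components (ball w \<delta> \<inter> \<Omega>)"
    have "w \<notin> \<Omega>" using w \<open>open \<Omega>\<close> frontier_disjoint_eq by blast
    then have "\<not> ball w \<delta> \<subseteq> \<Omega>" using \<delta> centre_in_ball by blast
    then obtain \<zeta> where \<zeta>: "\<zeta> \<in> ball w \<delta>" "\<zeta> \<in> frontier \<Omega>" "\<zeta> \<in> closure E"
      using component_accumulates_at_frontier[OF open_ball connected_ball \<open>open \<Omega>\<close> _ E] by blast
    obtain c r E' where "(c, r, E') \<in> boundary_pieces D \<Omega>" "E' \<subseteq> E"
      using boundary_piece_subset_component[OF assms E \<zeta>(3,2) open_ball \<zeta>(1) order_refl] .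
    then show "\<not> bounded (f ` E)"
      using unbounded bounded_subset[of "f ` E" "f ` E'"] by blast
  qed
qed

section \<open>Holomorphic extension across the boundary\<close>

text \<open>The bounds on the closed ball, rather than on smaller balls, make this a condition on \<open>h\<close> that
  is preserved under pointwise limits by a single application of Arzela-Ascoli.\<close>

definition Lipschitz_extends ::
  "complex ^ 'n \<Rightarrow> real \<Rightarrow> (complex ^ 'n) set \<Rightarrow> real \<Rightarrow> (complex ^ 'n \<Rightarrow> complex) \<Rightarrow> bool" where
  "Lipschitz_extends c r E m h \<longleftrightarrow> (\<exists>F. holo_on (ball c r) F \<and> (\<forall>z\<in>cball c r. cmod (F z) \<le> m)
     \<and> m-lipschitz_on (cball c r) F \<and> (\<forall>z\<in>E. F z = h z))"

lemma lipschitz_on_LIMSEQ: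
  assumes "\<And>n. L-lipschitz_on S (f n)" "\<And>x. x \<in> S \<Longrightarrow> (\<lambda>n. f n x) \<longlonglongrightarrow> g x"
  shows "L-lipschitz_on S g"
proof (rule lipschitz_onI)
  show "dist (g x) (g y) \<le> L * dist x y" if "x \<in> S" "y \<in> S" for x y
    using lipschitz_onD[OF assms(1) that]
    by (intro LIMSEQ_le_const2[OF tendsto_dist[OF assms(2)[OF that(1)] assms(2)[OF that(2)]]]) blast
  show "0 \<le> L" using lipschitz_on_nonneg[OF assms(1)] .
qed

lemma Arzela_Ascoli_lipschitz:
  fixes F :: "nat \<Rightarrow> 'a::euclidean_space \<Rightarrow> 'b::{real_normed_vector, heine_borel}"
  assumes "compact S" and bound: "\<And>n x. x \<in> S \<Longrightarrow> norm (F n x) \<le> B"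
    and lipschitz: "\<And>n. L-lipschitz_on S (F n)"
  obtains G k where "strict_mono (k :: nat \<Rightarrow> nat)" "uniform_limit S (\<lambda>n. F (k n)) G sequentially"
proof -
  have "L \<ge> 0" using lipschitz_on_nonneg[OF lipschitz] .
  have equicontinuous: "\<exists>d>0. \<forall>n y. y \<in> S \<and> norm (x - y) < d \<longrightarrow> norm (F n x - F n y) < e"
    if "x \<in> S" "e > 0" for x e
  proof (intro exI conjI allI impI)
    show "e / (L + 1) > 0" using \<open>e > 0\<close> \<open>L \<ge> 0\<close> by simp
    fix n y assume y: "y \<in> S \<and> norm (x - y) < e / (L + 1)"
    have "norm (F n x - F n y) \<le> L * norm (x - y)"
      using lipschitz_onD[OF lipschitz] \<open>x \<in> S\<close> y by (simp add: dist_norm)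
    also have "\<dots> \<le> L * (e / (L + 1))" using y \<open>L \<ge> 0\<close> by (intro mult_left_mono) auto
    also have "\<dots> < e" using \<open>e > 0\<close> \<open>L \<ge> 0\<close> by (simp add: field_simps)
    finally show "norm (F n x - F n y) < e" .
  qed
  obtain G k where "strict_mono (k :: nat \<Rightarrow> nat)"
    and "\<And>e. 0 < e \<Longrightarrow> \<exists>N. \<forall>n x. n \<ge> N \<and> x \<in> S \<longrightarrow> norm (F (k n) x - G x) < e"
    using Arzela_Ascoli[OF \<open>compact S\<close> bound equicontinuous] by metis
  then have "uniform_limit S (\<lambda>n. F (k n)) G sequentially"
    unfolding uniform_limit_sequentially_iff dist_norm by blast
  with \<open>strict_mono k\<close> show ?thesis by (rule that)
qed

lemma Lipschitz_extends_LIMSEQ: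
  assumes g: "\<And>n. Lipschitz_extends c r E m (g n)" and E: "E \<subseteq> ball c r"
    and lim: "\<And>z. z \<in> E \<Longrightarrow> (\<lambda>n. g n z) \<longlonglongrightarrow> h z"
  shows "Lipschitz_extends c r E m h"
proof -
  obtain F where F: "\<And>n. holo_on (ball c r) (F n)" "\<And>n z. z \<in> cball c r \<Longrightarrow> cmod (F n z) \<le> m"
    "\<And>n. m-lipschitz_on (cball c r) (F n)" "\<And>n z. z \<in> E \<Longrightarrow> F n z = g n z"
    using g unfolding Lipschitz_extends_def by metis
  obtain G k where k: "strict_mono (k :: nat \<Rightarrow> nat)"
    and unif: "uniform_limit (cball c r) (\<lambda>n. F (k n)) G sequentially"
    using Arzela_Ascoli_lipschitz[OF compact_cball F(2,3)] .
  have ptw: "(\<lambda>n. F (k n) z) \<longlonglongrightarrow> G z" if "z \<in> cball c r" for z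
    using unif that by (rule tendsto_uniform_limitI)
  have "holo_on (ball c r) G"
  proof (rule holo_on_uniform_sequence[OF F(1)])
    fix z assume "z \<in> ball c r"
    then obtain s where "s > 0" "cball z s \<subseteq> ball c r"
      using open_contains_cball[of "ball c r"] open_ball by blast
    moreover from this have "uniform_limit (cball z s) (\<lambda>n. F (k n)) G sequentially"
      using ball_subset_cball by (blast intro: uniform_limit_on_subset[OF unif])
    ultimately show
      "\<exists>s>0. cball z s \<subseteq> ball c r \<and> uniform_limit (cball z s) (\<lambda>n. F (k n)) G sequentially"
      by blast
  qed
  moreover have "cmod (G z) \<le> m" if "z \<in> cball c r" for z
    by (rule LIMSEQ_le_const2[OF tendsto_norm[OF ptw[OF that]]]) (use F(2) that in blast)
  moreover have "m-lipschitz_on (cball c r) G"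
    using F(3) ptw by (rule lipschitz_on_LIMSEQ)
  moreover have "G z = h z" if "z \<in> E" for z
  proof (rule LIMSEQ_unique)
    show "(\<lambda>n. F (k n) z) \<longlonglongrightarrow> G z" using that E ball_subset_cball by (blast intro: ptw)
    show "(\<lambda>n. F (k n) z) \<longlonglongrightarrow> h z"
      using LIMSEQ_subseq_LIMSEQ[OF lim[OF that] k] F(4)[OF that] by (simp add: o_def)
  qed
  ultimately show ?thesis unfolding Lipschitz_extends_def by blast
qed

lemma holo_on_extension_eq_on_component:
  assumes "open U" "open \<Omega>" and F: "holo_on U F" and h: "holo_on \<Omega> h"
    and V: "open V" "V \<noteq> {}" "V \<subseteq> U \<inter> \<Omega>" "\<And>z. z \<in> V \<Longrightarrow> F z = h z"
  obtains E where "E \<in> components (U \<inter> \<Omega>)" "\<And>z. z \<in> E \<Longrightarrow> F z = h z"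
proof -
  obtain v where v: "v \<in> V" using V(2) by blast
  let ?E = "connected_component_set (U \<inter> \<Omega>) v"
  have E: "?E \<in> components (U \<inter> \<Omega>)" using v V(3) by (intro componentsI) blast
  have sub: "?E \<subseteq> U" "?E \<subseteq> \<Omega>" using in_components_subset[OF E] by auto
  have "F z = h z" if "z \<in> ?E" for z
  proof (rule holo_on_identity[of ?E F h v])
    show "open ?E" using open_components[OF open_Int[OF assms(1,2)] E] .
    show "v \<in> ?E" using v V(3) by (simp add: connected_component_refl_eq subset_iff)
    show "\<forall>\<^sub>F z in nhds v. F z = h z" using V(1,4) v unfolding eventually_nhds by blast
  qed (use holo_on_subset[OF F sub(1)] holo_on_subset[OF h sub(2)] that in auto)
  then show ?thesis using E that by blast
qed

lemma holo_on_extension_imp_Lipschitz_extends: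
  assumes "closure D = UNIV" "open \<Omega>" "open U" "connected U" "\<not> U \<subseteq> \<Omega>"
    and F: "holo_on U F" and E: "E \<in> components (U \<inter> \<Omega>)" "\<And>z. z \<in> E \<Longrightarrow> F z = h z"
  obtains c r E' and m :: nat
  where "(c, r, E') \<in> boundary_pieces D \<Omega>" "Lipschitz_extends c r E' m h"
proof -
  obtain \<zeta> where \<zeta>: "\<zeta> \<in> U" "\<zeta> \<in> frontier \<Omega>" "\<zeta> \<in> closure E"
    using component_accumulates_at_frontier[OF assms(3,4,2,5) E(1)] .
  obtain s B where s: "s > 0" "cball \<zeta> s \<subseteq> U"
    and B: "\<And>w. w \<in> cball \<zeta> s \<Longrightarrow> cmod (F w) \<le> B" "B-lipschitz_on (cball \<zeta> s) F"
    using holo_on_locally_lipschitz[OF F \<open>open U\<close> \<zeta>(1)] by metis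
  obtain m :: nat where m: "B \<le> m" using real_arch_simple by blast
  have "ball \<zeta> s \<subseteq> U" "\<zeta> \<in> ball \<zeta> s" using s ball_subset_cball by auto
  then obtain c r E' where piece: "(c, r, E') \<in> boundary_pieces D \<Omega>"
    and sub: "cball c r \<subseteq> ball \<zeta> s" "E' \<subseteq> E"
    using boundary_piece_subset_component[OF assms(1,2) E(1) \<zeta>(3,2) open_ball] by metis
  have cball: "cball c r \<subseteq> cball \<zeta> s" using sub(1) ball_subset_cball by blast
  have "holo_on (ball c r) F"
    using ball_subset_cball cball s(2) by (blast intro: holo_on_subset[OF F])
  moreover have "cmod (F z) \<le> m" if "z \<in> cball c r" for z
    using B(1)[of z] that cball m by fastforce
  moreover have "m-lipschitz_on (cball c r) F"
    using B(2) cball m by (rule lipschitz_on_mono)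
  ultimately have "Lipschitz_extends c r E' m h"
    using E(2) sub(2) unfolding Lipschitz_extends_def by blast
  with piece show ?thesis by (rule that)
qed

lemma singular_at_boundary_iff:
  fixes \<Omega> :: "(complex ^ 'n) set"
  assumes "closure D = UNIV" "open \<Omega>" "holo_on \<Omega> h"
  shows "singular_at_boundary \<Omega> h \<longleftrightarrow>
    (\<forall>(c, r, E)\<in>boundary_pieces D \<Omega>. \<forall>m::nat. \<not> Lipschitz_extends c r E m h)"
proof
  assume singular: "singular_at_boundary \<Omega> h"
  have "\<not> Lipschitz_extends c r E m h"
    if piece: "(c, r, E) \<in> boundary_pieces D \<Omega>" for c r E and m :: nat
  proof
    assume "Lipschitz_extends c r E m h"
    then obtain F where F: "holo_on (ball c r) F" "\<forall>z\<in>E. F z = h z"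
      unfolding Lipschitz_extends_def by blast
    note E = boundary_piecesD[OF piece]
    have "open E" using open_components[OF open_Int[OF open_ball \<open>open \<Omega>\<close>] E(3)] .
    moreover have "E \<noteq> {}" using E(3) by (rule in_components_nonempty)
    moreover have "ball c r \<inter> \<Omega> \<noteq> ball c r" using E(2) by blast
    ultimately show False
      using singular F E(4,5) unfolding singular_at_boundary_def
      by (metis Int_subset_iff connected_ball open_ball)
  qed
  then show "\<forall>(c, r, E)\<in>boundary_pieces D \<Omega>. \<forall>m::nat. \<not> Lipschitz_extends c r E m h" by blast
next
  assume not_extends: "\<forall>(c, r, E)\<in>boundary_pieces D \<Omega>. \<forall>m::nat. \<not> Lipschitz_extends c r E m h"
  show "singular_at_boundary \<Omega> h"
    unfolding singular_at_boundary_def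
  proof (intro allI impI notI, elim conjE exE)
    fix U V F
    assume U: "open U" "connected U" "U \<inter> \<Omega> \<noteq> U" and F: "holo_on U F"
      and V: "open V" "V \<noteq> {}" "V \<subseteq> U \<inter> \<Omega>" "\<forall>z\<in>V. F z = h z"
    obtain E where E: "E \<in> components (U \<inter> \<Omega>)" "\<And>z. z \<in> E \<Longrightarrow> F z = h z"
      using holo_on_extension_eq_on_component[OF U(1) \<open>open \<Omega>\<close> F \<open>holo_on \<Omega> h\<close> V(1-3)] V(4) by metis
    have "\<not> U \<subseteq> \<Omega>" using U(3) by blast
    then obtain c r E' and m :: nat
      where "(c, r, E') \<in> boundary_pieces D \<Omega>" "Lipschitz_extends c r E' m h"
      using holo_on_extension_imp_Lipschitz_extends[OF assms(1,2) U(1,2) _ F E] by metis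
    then show False using not_extends by blast
  qed
qed

lemma totally_unbounded_imp_singular:
  fixes \<Omega> :: "(complex ^ 'n) set"
  assumes "open \<Omega>" "holo_on \<Omega> h" and unbounded: "totally_unbounded \<Omega> h"
  shows "singular_at_boundary \<Omega> h"
proof -
  have "\<not> Lipschitz_extends c r E m h"
    if piece: "(c, r, E) \<in> boundary_pieces UNIV \<Omega>" for c r E and m :: nat
  proof
    assume "Lipschitz_extends c r E m h"
    then have "cmod (h z) \<le> m" if "z \<in> E" for z
      using that boundary_piecesD(4)[OF piece] ball_subset_cball[of c r]
      unfolding Lipschitz_extends_def by (metis subsetD)
    then have "bounded (h ` E)" by (auto simp: bounded_iff)
    then show False
      using unbounded piece totally_unbounded_iff[OF closure_UNIV \<open>open \<Omega>\<close>] by blast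
  qed
  then show ?thesis
    using singular_at_boundary_iff[OF closure_UNIV assms(1,2)] by blast
qed

section \<open>Generic functions are totally unbounded\<close>

lemma unbounded_image_if_filterlim_at_infinity:
  fixes k :: "'a::metric_space \<Rightarrow> 'b::real_normed_vector"
  assumes lim: "filterlim k at_infinity (at \<zeta> within S)"
    and "\<zeta> \<in> closure E" "\<zeta> \<notin> E" "E \<subseteq> S"
  shows "\<not> bounded (k ` E)"
proof
  assume "bounded (k ` E)"
  then obtain B where B: "\<And>z. z \<in> E \<Longrightarrow> norm (k z) \<le> B" by (auto simp: bounded_iff)
  have "filterlim k at_infinity (at \<zeta> within E)"
    using lim at_le[OF \<open>E \<subseteq> S\<close>] by (rule filterlim_mono[OF _ order_refl])
  then have "\<forall>\<^sub>F z in at \<zeta> within E. B + 1 \<le> norm (k z)"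
    using filterlim_at_infinity_imp_norm_at_top unfolding filterlim_at_top by blast
  moreover have "\<forall>\<^sub>F z in at \<zeta> within E. z \<in> E"
    by (simp add: eventually_at_filter)
  ultimately have "\<forall>\<^sub>F z in at \<zeta> within E. False"
    by eventually_elim (use B in force)
  moreover have "at \<zeta> within E \<noteq> bot"
    using assms(2,3) not_trivial_limit_within[of \<zeta> E] by simp
  ultimately show False by simp
qed

lemma unbounded_image_add_scaleR:
  fixes f k :: "'a \<Rightarrow> 'b::real_normed_vector"
  assumes "bounded (f ` E)" "\<not> bounded (k ` E)" "a \<noteq> 0"
  shows "\<not> bounded ((\<lambda>z. f z + a *\<^sub>R k z) ` E)"
proof
  assume "bounded ((\<lambda>z. f z + a *\<^sub>R k z) ` E)"
  then have "bounded ((\<lambda>z. (1 / a) *\<^sub>R (f z + a *\<^sub>R k z - f z)) ` E)"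
    using assms(1) by (intro bounded_scaleR_comp bounded_minus_comp)
  then show False using assms(2,3) by simp
qed

lemma gdelta_in_INT_openin:
  assumes "countable I" "\<And>i. i \<in> I \<Longrightarrow> openin T (U i)"
  shows "gdelta_in T (topspace T \<inter> (\<Inter>i\<in>I. U i))"
proof -
  have "gdelta_in T (\<Inter>(insert (topspace T) (U ` I)))"
    using assms by (intro gdelta_in_Inter) (auto intro: open_imp_gdelta_in)
  then show ?thesis by simp
qed

context OL_space
begin

lemma OL_open_iff: "OL_open q ps \<Omega> U \<longleftrightarrow> openin M.mtopology U"
proof -
  have "(\<forall>g\<in>X. OLdist ps \<Omega> f g < e \<longrightarrow> g \<in> U) \<longleftrightarrow> M.mball f e \<subseteq> U" if "f \<in> X" for f e
    using that by (auto simp: M.mball_def)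
  then show ?thesis
    unfolding OL_open_def M.openin_mtopology Ball_def by (meson subsetD)
qed

lemma OL_Gdelta_iff: "OL_Gdelta q ps \<Omega> A \<longleftrightarrow> gdelta_in M.mtopology A"
proof
  assume "OL_Gdelta q ps \<Omega> A"
  then obtain U :: "nat \<Rightarrow> _" where U: "\<And>k. openin M.mtopology (U k)" "A = \<Inter>(range U)"
    unfolding OL_Gdelta_def OL_open_iff by blast
  show "gdelta_in M.mtopology A"
    unfolding U(2) by (intro gdelta_in_Inter) (auto intro: open_imp_gdelta_in U(1))
next
  assume "gdelta_in M.mtopology A"
  then show "OL_Gdelta q ps \<Omega> A"
    unfolding OL_Gdelta_def OL_open_iff gdelta_in_descending by metis
qed

lemma OL_dense_iff: "OL_dense q ps \<Omega> A \<longleftrightarrow> A \<subseteq> X \<and> M.mtopology closure_of A = X"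
proof -
  have "M.mtopology closure_of A = {f \<in> X. \<forall>e>0. \<exists>g\<in>A. OLdist ps \<Omega> f g < e}" if "A \<subseteq> X"
    unfolding M.metric_closure_of using that by (auto simp: subset_iff)
  then show ?thesis unfolding OL_dense_def by blast
qed

definition exceeding :: "(complex ^ 'n) set \<Rightarrow> real \<Rightarrow> (complex ^ 'n \<Rightarrow> complex) set" where
  "exceeding E m = {g \<in> X. \<exists>z\<in>E. m < cmod (g z)}"

lemma openin_exceeding:
  assumes "E \<subseteq> \<Omega>"
  shows "openin M.mtopology (exceeding E m)"
proof -
  have "exceeding E m = (\<Union>z\<in>E. {g \<in> topspace M.mtopology. g z \<in> {w. m < cmod w}})"
    by (auto simp: exceeding_def)
  also have "openin M.mtopology \<dots>"
  proof (intro openin_Union, elim imageE, hypsubst)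
    fix z assume "z \<in> E"
    then have "z \<in> \<Omega>" using assms by blast
    have "openin euclidean {w :: complex. m < cmod w}"
      unfolding open_openin[symmetric] by (intro open_Collect_less continuous_intros)
    then show "openin M.mtopology {g \<in> topspace M.mtopology. g z \<in> {w. m < cmod w}}"
      by (rule openin_continuous_map_preimage[OF continuous_map_evaluation[OF \<open>z \<in> \<Omega>\<close>]])
  qed
  finally show ?thesis .
qed

lemma limitin_perturbation:
  assumes "f \<in> X" "k \<in> X"
  shows "limitin M.mtopology (\<lambda>n z. f z + inverse (real (Suc n)) *\<^sub>R k z) f sequentially"
proof (rule limitin_if_seminorms_tendsto_0)
  show "(\<lambda>z. f z + inverse (real (Suc n)) *\<^sub>R k z) \<in> X" for n
    using assms by (intro OLq_add OLq_scaleR)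
  show "(\<lambda>n. Lp_seminorm (ps j) vol (\<lambda>z. f z + inverse (real (Suc n)) *\<^sub>R k z - f z)) \<longlonglongrightarrow> 0" for j
    using tendsto_mult_left_zero[OF LIMSEQ_inverse_real_of_nat, of "Lp_seminorm (ps j) vol k"]
    by (simp add: Lp_seminorm_scaleR[OF ps_pos Lp_spaceD(1)[OF OLq_Lp_space[OF assms(2)]]])
qed fact

lemma exceeding_dense:
  assumes k: "k \<in> X" "\<not> bounded (k ` E)"
  shows "M.mtopology closure_of (exceeding E m) = X"
proof (rule antisym)
  show "X \<subseteq> M.mtopology closure_of (exceeding E m)"
  proof
    fix f assume f: "f \<in> X"
    show "f \<in> M.mtopology closure_of (exceeding E m)"
    proof (cases "bounded (f ` E)")
      case True
      let ?g = "\<lambda>n z. f z + inverse (real (Suc n)) *\<^sub>R k z"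
      have "?g n \<in> exceeding E m" for n
      proof -
        have "\<not> bounded (?g n ` E)" using True k(2) by (intro unbounded_image_add_scaleR) auto
        then show ?thesis
          using OLq_add[OF f OLq_scaleR[OF k(1)]] by (auto simp: exceeding_def bounded_iff not_le)
      qed
      then have "range ?g \<subseteq> exceeding E m \<inter> X" by (auto simp: exceeding_def)
      with f limitin_perturbation[OF f k(1)] show ?thesis
        unfolding M.closure_of_sequentially mem_Collect_eq by (intro conjI exI[of _ ?g])
    next
      case False
      then have "f \<in> exceeding E m"
        using f by (auto simp: exceeding_def bounded_iff not_le)
      then show ?thesis
        using closure_of_subset[of "exceeding E m" M.mtopology] by (auto simp: exceeding_def)
    qed
  qed
qed (use closure_of_subset_topspace in force)

lemma closedin_Lipschitz_extends:
  assumes "E \<subseteq> ball c r" "E \<subseteq> \<Omega>"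
  shows "closedin M.mtopology {h \<in> X. Lipschitz_extends c r E m h}"
  unfolding M.metric_closedin_iff_sequentially_closed
proof (intro conjI allI impI)
  fix g h
  assume "range g \<subseteq> {h \<in> X. Lipschitz_extends c r E m h} \<and> limitin M.mtopology g h sequentially"
  then have g: "\<And>n. Lipschitz_extends c r E m (g n)" and lim: "limitin M.mtopology g h sequentially"
    by auto
  have "Lipschitz_extends c r E m h"
  proof (rule Lipschitz_extends_LIMSEQ[OF g assms(1)])
    show "(\<lambda>n. g n z) \<longlonglongrightarrow> h z" if "z \<in> E" for z
      using limitin_imp_LIMSEQ[OF lim] assms(2) that by blast
  qed
  then show "h \<in> {h \<in> X. Lipschitz_extends c r E m h}"
    using M.limitin_mspace[OF lim] by simp
qed auto

context
  fixes D :: "(complex ^ 'n) set"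
  assumes countable_D: "countable D" and dense_D: "closure D = UNIV"
begin

lemma countable_boundary_pieces_times_nat: "countable (boundary_pieces D \<Omega> \<times> (UNIV :: nat set))"
  using countable_boundary_pieces[OF countable_D open_dom] by simp

lemma totally_unbounded_eq_INT_exceeding:
  "{g \<in> X. totally_unbounded \<Omega> g}
    = X \<inter> (\<Inter>((c, r, E), m) \<in> boundary_pieces D \<Omega> \<times> (UNIV :: nat set). exceeding E m)"
proof -
  have "\<not> bounded (g ` E) \<longleftrightarrow> (\<forall>m::nat. g \<in> exceeding E m)" if "g \<in> X" for g E
  proof
    show "\<not> bounded (g ` E)" if exceeds: "\<forall>m::nat. g \<in> exceeding E m"
    proof
      assume "bounded (g ` E)"
      then obtain B where B: "\<And>z. z \<in> E \<Longrightarrow> cmod (g z) \<le> B" by (auto simp: bounded_iff)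
      obtain m :: nat where "B \<le> m" using real_arch_simple by blast
      obtain z where "z \<in> E" "m < cmod (g z)"
        using exceeds[THEN spec, of m] by (auto simp: exceeding_def)
      with B[of z] \<open>B \<le> m\<close> show False by simp
    qed
  qed (use \<open>g \<in> X\<close> in \<open>auto simp: exceeding_def bounded_iff not_le\<close>)
  then show ?thesis
    unfolding totally_unbounded_iff[OF dense_D open_dom] by fastforce
qed

lemma singular_eq_INT_not_Lipschitz_extends:
  "{h \<in> X. singular_at_boundary \<Omega> h}
    = X \<inter> (\<Inter>((c, r, E), m) \<in> boundary_pieces D \<Omega> \<times> (UNIV :: nat set).
        X - {h \<in> X. Lipschitz_extends c r E m h})"
proof -
  have "singular_at_boundary \<Omega> h \<longleftrightarrow> (\<forall>(c, r, E)\<in>boundary_pieces D \<Omega>.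
      \<forall>m::nat. h \<in> X - {h \<in> X. Lipschitz_extends c r E m h})" if "h \<in> X" for h
    using that by (simp add: singular_at_boundary_iff[OF dense_D open_dom OLq_holo_on])
  then show ?thesis by fastforce
qed

lemma gdelta_in_totally_unbounded: "gdelta_in M.mtopology {g \<in> X. totally_unbounded \<Omega> g}"
proof -
  have "gdelta_in M.mtopology (topspace M.mtopology \<inter>
      (\<Inter>((c, r, E), m) \<in> boundary_pieces D \<Omega> \<times> (UNIV :: nat set). exceeding E m))"
    by (intro gdelta_in_INT_openin countable_boundary_pieces_times_nat)
      (auto intro: openin_exceeding[OF boundary_piecesD(5)])
  then show ?thesis by (simp add: totally_unbounded_eq_INT_exceeding)
qed

lemma gdelta_in_singular: "gdelta_in M.mtopology {h \<in> X. singular_at_boundary \<Omega> h}"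
proof -
  have "openin M.mtopology (X - {h \<in> X. Lipschitz_extends c r E m h})"
    if "(c, r, E) \<in> boundary_pieces D \<Omega>" for c r E m
    using openin_diff
      [OF openin_topspace closedin_Lipschitz_extends[OF boundary_piecesD(4,5)[OF that]]]
    by simp
  then have "gdelta_in M.mtopology (topspace M.mtopology \<inter>
      (\<Inter>((c, r, E), m) \<in> boundary_pieces D \<Omega> \<times> (UNIV :: nat set).
        X - {h \<in> X. Lipschitz_extends c r E m h}))"
    by (intro gdelta_in_INT_openin countable_boundary_pieces_times_nat) auto
  then show ?thesis by (simp add: singular_eq_INT_not_Lipschitz_extends)
qed

lemma totally_unbounded_dense:
  assumes blowup: "\<forall>\<zeta>\<in>frontier \<Omega>. \<exists>k\<in>X. filterlim k at_infinity (at \<zeta> within \<Omega>)"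
  shows "M.mtopology closure_of {g \<in> X. totally_unbounded \<Omega> g} = X"
proof -
  define \<G> where
    "\<G> = insert X ((\<lambda>((c, r, E), m::nat). exceeding E m) ` (boundary_pieces D \<Omega> \<times> UNIV))"
  have "openin M.mtopology (exceeding E m) \<and> M.mtopology closure_of (exceeding E m) = X"
    if piece: "(c, r, E) \<in> boundary_pieces D \<Omega>" for c r E m
  proof
    note E = boundary_piecesD(5)[OF piece]
    show "openin M.mtopology (exceeding E m)" using E by (rule openin_exceeding)
    obtain \<zeta> where \<zeta>: "\<zeta> \<in> frontier \<Omega>" "\<zeta> \<in> closure E"
      using boundary_piece_accumulates_at_frontier[OF open_dom piece] .
    then obtain k where k: "k \<in> X" "filterlim k at_infinity (at \<zeta> within \<Omega>)" using blowup by blast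
    have "\<zeta> \<notin> E" using \<zeta>(1) E open_dom frontier_disjoint_eq by blast
    then have "\<not> bounded (k ` E)"
      using unbounded_image_if_filterlim_at_infinity[OF k(2) \<zeta>(2) _ E] by blast
    with k(1) show "M.mtopology closure_of (exceeding E m) = X" by (rule exceeding_dense)
  qed
  moreover have "openin M.mtopology X \<and> M.mtopology closure_of X = X"
    using openin_topspace[of M.mtopology] closure_of_topspace[of M.mtopology] by simp
  ultimately have "M.mtopology closure_of \<Inter>\<G> = X"
    using countable_boundary_pieces_times_nat
    by (intro M.metric_Baire_category[OF mcomplete]) (auto simp: \<G>_def)
  then show ?thesis
    unfolding totally_unbounded_eq_INT_exceeding by (simp add: \<G>_def)
qed

end

end

theorem theorem4:
  fixes \<Omega> :: "(complex ^ 'n) set" and q :: ereal and ps :: "nat \<Rightarrow> real"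
  assumes "bounded \<Omega>" and "open \<Omega>" and "q > 1"
    and "admissible_seq q ps"
    and "\<forall>\<zeta>\<in>frontier \<Omega>. \<exists>f\<in>OLq q \<Omega>. filterlim f at_infinity (at \<zeta> within \<Omega>)"
  shows "OL_dense q ps \<Omega> {g\<in>OLq q \<Omega>. totally_unbounded \<Omega> g}
       \<and> OL_Gdelta q ps \<Omega> {g\<in>OLq q \<Omega>. totally_unbounded \<Omega> g}
       \<and> OL_dense q ps \<Omega> {h\<in>OLq q \<Omega>. singular_at_boundary \<Omega> h}
       \<and> OL_Gdelta q ps \<Omega> {h\<in>OLq q \<Omega>. singular_at_boundary \<Omega> h}"
proof -
  interpret OL_space \<Omega> q ps by unfold_locales fact+
  obtain D :: "(complex ^ 'n) set" where D: "countable D" "closure D = UNIV"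
    using separable[of "UNIV :: (complex ^ 'n) set"] by (metis top.extremum_unique)
  let ?TU = "{g \<in> X. totally_unbounded \<Omega> g}" and ?SB = "{h \<in> X. singular_at_boundary \<Omega> h}"
  have TU_dense: "OL_dense q ps \<Omega> ?TU"
    using totally_unbounded_dense[OF D assms(5)] unfolding OL_dense_iff by blast
  have "?TU \<subseteq> ?SB"
    using totally_unbounded_imp_singular[OF open_dom OLq_holo_on] by blast
  then have SB_dense: "OL_dense q ps \<Omega> ?SB"
    using TU_dense unfolding OL_dense_def by blast
  show ?thesis
    using TU_dense SB_dense gdelta_in_totally_unbounded[OF D] gdelta_in_singular[OF D]
    unfolding OL_Gdelta_iff by blast
qed

end
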